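(* Let $r,q\in\mathbb{N}$ with $q\ge2$, $n=rq+1$, and let $w=w_{r,n}$. Let $u\in U_{w}$. Then $uwP/P\in X(w)^{ss}_{T_{J_{r}}}(\mathcal{L}(n\omega_{r}))$ if and only if for every $1\leq j\leq r$ there exists $i\in C_{j}$ with $X_{\beta_{i,j}}(u)\neq 0$.
   Context: $G=PSL(n,\mathbb{C})$, $T\subset B\subset G$ a maximal torus and Borel subgroup (say, images of diagonal and upper triangular matrices), simple roots $\alpha_1,\dots,\alpha_{n-1}$, simple reflections $s_i$, fundamental weights $\omega_i$, one-parameter subgroups $\lambda_i$ of $T$ dual to the simple roots ($\langle\alpha_i,\lambda_j\rangle=\delta_{ij}$). $P$ is the standard maximal parabolic corresponding to $\alpha_r$, so $G/P=G_{r,n}$ is the Grassmannian. $\mathcal{L}(n\omega_r)$ is $\mathcal{O}(n)$ for the Plücker embedding with its natural $G$-linearization. $$w_{r,n}=(s_q\cdots s_1)(s_{2q}\cdots s_2)\cdots(s_{rq}\cdots s_r)$$ (one-line notation $(q+1,2q+1,\dots,rq+1)$), $X(w)=\overline{BwP/P}$. $T_{J_r}\subseteq T$ is the subtorus generated by $\lambda_{jq}(\mathbb{G}_m)$, $1\le j\le r$. $X(w)^{ss}_{T_{J_r}}(\mathcal{L}(n\omega_r))$ is the set of $x\in X(w)$ at which some $T_{J_r}$-invariant section of some positive power of $\mathcal{L}(n\omega_r)$ on $X(w)$ does not vanish. For $1\le j\le r$: $C_j=\{1,2,\dots,jq+1\}\setminus\{lq+1:1\le l\le j\}$, and for $i\in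 C_j$, $\beta_{i,j}=\sum_{k=i}^{jq}\alpha_k$. The set $R^+(w^{-1})$ of positive roots $\beta$ with $w^{-1}(\beta)<0$ equals $\{\beta_{i,j}:1\le j\le r,\ i\in C_j\}$. With root subgroup isomorphisms $u_\beta:\mathbb{C}\to U_\beta$, $U_w=\prod_{1\le j\le r,\,i\in C_j}U_{\beta_{i,j}}$ (the factors commute), and $X_{\beta_{i,j}}$ is the coordinate function $X_{\beta_{i,j}}\big(\prod u_{\beta_{k,l}}(a_{k,l})\big)=a_{i,j}$. The map $u\mapsto uwP/P$ is an isomorphism of $U_w$ onto the open cell $BwP/P$ of $X(w)$. *)

theory Defs
  imports
    "HOL-Algebra.Left_Coset"
    "HOL-Algebra.Generated_Groups"
    "Jordan_Normal_Form.Determinant"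
    "Jordan_Normal_Form.DL_Submatrix"
    "Jordan_Normal_Form.Gauss_Jordan_Elimination"
begin

text \<open>
  Matrix rows and columns are indexed by \<open>0, \<dots>, n - 1\<close>, whereas roots, simple reflections
  and one-parameter subgroups keep their customary indices \<open>1, \<dots>, n - 1\<close>.
\<close>

section \<open>The group and its standard subgroups\<close>

definition SL :: "nat \<Rightarrow> complex mat monoid" where
  "SL n = \<lparr>carrier = {A \<in> carrier_mat n n. det A = 1}, monoid.mult = (*), one = 1\<^sub>m n\<rparr>"

definition SL_center :: "nat \<Rightarrow> complex mat set" where
  "SL_center n = {Z \<in> carrier (SL n). \<forall>A \<in> carrier (SL n). Z * A = A * Z}"

text \<open>Elements of \<open>PSL n\<close> are cosets of the center, i.e. sets of matrices.\<close>

definition PSL :: "nat \<Rightarrow> complex mat set monoid" where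
  "PSL n = SL n Mod SL_center n"

definition proj :: "nat \<Rightarrow> complex mat \<Rightarrow> complex mat set" where
  "proj n A = SL_center n #>\<^bsub>SL n\<^esub> A"

definition torus :: "nat \<Rightarrow> complex mat set set" where
  "torus n = proj n ` {A \<in> carrier (SL n). diagonal_mat A}"

definition borel_subgroup :: "nat \<Rightarrow> complex mat set set" where
  "borel_subgroup n = proj n ` {A \<in> carrier (SL n). upper_triangular A}"

text \<open>The standard maximal parabolic of \<open>\<alpha>\<^sub>r\<close>: the stabilizer of the span of the first \<open>r\<close>
  basis vectors.\<close>

definition max_parabolic :: "nat \<Rightarrow> nat \<Rightarrow> complex mat set set" where
  "max_parabolic n r =
     proj n ` {A \<in> carrier (SL n). \<forall>i<n. \<forall>j<n. r \<le> i \<longrightarrow> j < r \<longrightarrow> A $$ (i, j) = 0}"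

text \<open>Characters of the torus are written multiplicatively. The quotient of two diagonal entries is
  the same for all representatives of \<open>t\<close>.\<close>

definition simple_root :: "nat \<Rightarrow> complex mat set \<Rightarrow> complex" where
  "simple_root i t = (THE z. \<exists>A\<in>t. z = A $$ (i - 1, i - 1) / A $$ (i, i))"

text \<open>The positive root \<open>\<alpha>\<^sub>i + \<dots> + \<alpha>\<^sub>l\<close>, i.e. \<open>\<epsilon>\<^sub>i - \<epsilon>\<^sub>l\<^sub>+\<^sub>1\<close>, and its root subgroup.\<close>

definition pos_root :: "nat \<Rightarrow> nat \<Rightarrow> complex mat set \<Rightarrow> complex" where
  "pos_root i l t = (\<Prod>k=i..l. simple_root k t)"

definition root_subgroup :: "nat \<Rightarrow> nat \<Rightarrow> nat \<Rightarrow> complex mat set set" where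
  "root_subgroup n i l = range (\<lambda>a. proj n (addrow_mat n a (i - 1) l))"

text \<open>Root subgroup isomorphisms. The equivariance condition excludes the non-algebraic
  automorphisms of the additive group of complex numbers.\<close>

definition root_subgroup_iso :: "nat \<Rightarrow> nat \<Rightarrow> nat \<Rightarrow> (complex \<Rightarrow> complex mat set) \<Rightarrow> bool" where
  "root_subgroup_iso n i l x \<longleftrightarrow>
     x \<in> iso \<lparr>carrier = UNIV, monoid.mult = (+), one = 0\<rparr> (PSL n\<lparr>carrier := root_subgroup n i l\<rparr>) \<and>
     (\<forall>t\<in>torus n. \<forall>a. t \<otimes>\<^bsub>PSL n\<^esub> x a \<otimes>\<^bsub>PSL n\<^esub> inv\<^bsub>PSL n\<^esub> t = x (pos_root i l t * a))"

text \<open>The one-parameter subgroup \<open>\<lambda>\<^sub>j\<close> dual to the simple roots; as \<open>PSL n\<close> is adjoint, its values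
  are determined by those of the simple roots on them.\<close>

definition dual_cochar :: "nat \<Rightarrow> nat \<Rightarrow> complex \<Rightarrow> complex mat set" where
  "dual_cochar n j z =
     (THE t. t \<in> torus n \<and> (\<forall>i\<in>{1..<n}. simple_root i t = (if i = j then z else 1)))"

definition T_J :: "nat \<Rightarrow> nat \<Rightarrow> nat \<Rightarrow> complex mat set set" where
  "T_J n r q = generate (PSL n) (\<Union>j\<in>{1..r}. dual_cochar n (j * q) ` (UNIV - {0}))"

section \<open>The Weyl group element and the unipotent group\<close>

definition simple_refl :: "nat \<Rightarrow> nat \<Rightarrow> complex mat" where
  "simple_refl n i = mat n n (\<lambda>(a, b).
     if a = i - 1 \<and> b = i then 1
     else if a = i \<and> b = i - 1 then -1
     else if a = b \<and> a \<noteq> i - 1 \<and> a \<noteq> i then 1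
     else 0)"

definition mult_list :: "('a, 'b) monoid_scheme \<Rightarrow> 'a list \<Rightarrow> 'a" where
  "mult_list G xs = foldr (monoid.mult G) xs (one G)"

text \<open>The word \<open>(s\<^sub>q \<cdots> s\<^sub>1)(s\<^sub>2\<^sub>q \<cdots> s\<^sub>2) \<cdots> (s\<^sub>r\<^sub>q \<cdots> s\<^sub>r)\<close>, and the representative of its product in the
  normalizer of the torus that is obtained from those of the simple reflections.\<close>

definition w_word :: "nat \<Rightarrow> nat \<Rightarrow> nat list" where
  "w_word r q = concat (map (\<lambda>j. rev [j..<Suc (j * q)]) [1..<Suc r])"

definition w_rep :: "nat \<Rightarrow> nat \<Rightarrow> nat \<Rightarrow> complex mat set" where
  "w_rep n r q = mult_list (PSL n) (map (\<lambda>i. proj n (simple_refl n i)) (w_word r q))"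

definition C_set :: "nat \<Rightarrow> nat \<Rightarrow> nat set" where
  "C_set q j = {1..j * q + 1} - {l * q + 1 | l. 1 \<le> l \<and> l \<le> j}"

text \<open>The pairs \<open>(i, j)\<close> indexing the roots \<open>\<beta>\<^sub>i\<^sub>,\<^sub>j = \<alpha>\<^sub>i + \<dots> + \<alpha>\<^sub>j\<^sub>q\<close>. The corresponding root subgroups
  commute, so the order in this list is immaterial.\<close>

definition beta_indices :: "nat \<Rightarrow> nat \<Rightarrow> (nat \<times> nat) list" where
  "beta_indices r q =
     concat (map (\<lambda>j. map (\<lambda>i. (i, j)) (sorted_list_of_set (C_set q j))) [1..<Suc r])"

definition U_w :: "nat \<Rightarrow> nat \<Rightarrow> nat \<Rightarrow> complex mat set set" where
  "U_w n r q = {mult_list (PSL n) (map (\<lambda>(i, j). g i j) (beta_indices r q)) | g.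
     \<forall>j\<in>{1..r}. \<forall>i\<in>C_set q j. g i j \<in> root_subgroup n i (j * q)}"

text \<open>The coordinate function \<open>X\<^sub>\<beta>\<close> for \<open>\<beta> = \<beta>\<^sub>i\<^sub>,\<^sub>j\<close>, with respect to the root subgroup isomorphisms
  \<open>x k l\<close> of the \<open>\<beta>\<^sub>k\<^sub>,\<^sub>l\<close>.\<close>

definition X_beta ::
  "nat \<Rightarrow> nat \<Rightarrow> nat \<Rightarrow> (nat \<Rightarrow> nat \<Rightarrow> complex \<Rightarrow> complex mat set) \<Rightarrow> nat \<Rightarrow> nat \<Rightarrow>
   complex mat set \<Rightarrow> complex" where
  "X_beta n r q x i j u = (THE c. \<exists>a.
     u = mult_list (PSL n) (map (\<lambda>(k, l). x k l (a k l)) (beta_indices r q)) \<and> a i j = c)"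

section \<open>The Grassmannian in its Pluecker embedding\<close>

text \<open>A point of \<open>G/P\<close> is a left coset of \<open>P\<close> in \<open>PSL n\<close>, hence a set of sets of matrices. Vectors in
  the \<open>r\<close>-th exterior power of the standard representation are functions on \<open>r\<close>-element subsets of
  \<open>{0..<n}\<close>, extended by zero.\<close>

definition grass :: "nat \<Rightarrow> nat \<Rightarrow> complex mat set set set" where
  "grass n r = lcosets\<^bsub>PSL n\<^esub> (max_parabolic n r)"

definition subsets_of_size :: "nat \<Rightarrow> nat \<Rightarrow> nat set set" where
  "subsets_of_size n r = {I. I \<subseteq> {0..<n} \<and> card I = r}"

definition plucker :: "nat \<Rightarrow> nat \<Rightarrow> complex mat \<Rightarrow> nat set \<Rightarrow> complex" where
  "plucker n r A I = (if I \<in> subsets_of_size n r then det (submatrix A I {0..<r}) else 0)"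

text \<open>The nonzero vectors on the lines which are the images of the points of \<open>Y \<subseteq> G/P\<close>.\<close>

definition cone :: "nat \<Rightarrow> nat \<Rightarrow> complex mat set set set \<Rightarrow> (nat set \<Rightarrow> complex) set" where
  "cone n r Y = {\<lambda>I. c * plucker n r A I | c A. c \<noteq> 0 \<and> (\<exists>y\<in>Y. A \<in> \<Union>y)}"

text \<open>Homogeneous polynomials of degree \<open>d\<close> in the Pluecker coordinates, as functions.\<close>

definition homog_polys :: "nat \<Rightarrow> nat \<Rightarrow> nat \<Rightarrow> ((nat set \<Rightarrow> complex) \<Rightarrow> complex) set" where
  "homog_polys n r d =
     {\<lambda>v. \<Sum>e\<in>E. c e * (\<Prod>I\<in>subsets_of_size n r. v I ^ e I) | (E :: (nat set \<Rightarrow> nat) set) c.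
        finite E \<and> (\<forall>e\<in>E. (\<Sum>I\<in>subsets_of_size n r. e I) = d)}"

definition zariski_closure ::
  "nat \<Rightarrow> nat \<Rightarrow> complex mat set set set \<Rightarrow> complex mat set set set" where
  "zariski_closure n r Y = {y \<in> grass n r. \<forall>d. \<forall>f\<in>homog_polys n r d.
     (\<forall>v\<in>cone n r Y. f v = 0) \<longrightarrow> (\<forall>v\<in>cone n r {y}. f v = 0)}"

definition schubert_variety :: "nat \<Rightarrow> nat \<Rightarrow> complex mat set \<Rightarrow> complex mat set set set" where
  "schubert_variety n r w = zariski_closure n r
     ((\<lambda>b. (b \<otimes>\<^bsub>PSL n\<^esub> w) <#\<^bsub>PSL n\<^esub> max_parabolic n r) ` borel_subgroup n)"

section \<open>Sections and semistable points\<close>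

text \<open>Global sections of \<open>\<O>(k)\<close> over \<open>Y\<close>: functions on the cone over \<open>Y\<close> that are locally in the
  Zariski topology quotients of homogeneous polynomials whose degrees differ by \<open>k\<close>. They are
  automatically homogeneous of degree \<open>k\<close>; only their values on \<open>cone n r Y\<close> matter. It suffices to
  consider principal open neighbourhoods, since any smaller neighbourhood of a point contains one
  on which numerator and denominator can be multiplied by its equation.\<close>

definition sections_O ::
  "nat \<Rightarrow> nat \<Rightarrow> complex mat set set set \<Rightarrow> nat \<Rightarrow> ((nat set \<Rightarrow> complex) \<Rightarrow> complex) set" where
  "sections_O n r Y k = {s. \<forall>v\<in>cone n r Y. \<exists>d. \<exists>f\<in>homog_polys n r (d + k). \<exists>h\<in>homog_polys n r d.
     h v \<noteq> 0 \<and> (\<forall>v'\<in>cone n r Y. h v' \<noteq> 0 \<longrightarrow> s v' = f v' / h v')}"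

text \<open>The action of a matrix on the exterior power.\<close>

definition ext_act :: "nat \<Rightarrow> nat \<Rightarrow> complex mat \<Rightarrow> (nat set \<Rightarrow> complex) \<Rightarrow> nat set \<Rightarrow> complex" where
  "ext_act n r A v I = (if I \<in> subsets_of_size n r
     then \<Sum>J\<in>subsets_of_size n r. det (submatrix A I J) * v J else 0)"

text \<open>The center of \<open>SL n\<close> acts trivially on sections of \<open>\<O>(n * m)\<close>, so the action of \<open>SL n\<close> on
  them factors through \<open>PSL n\<close>. This is the linearization of \<open>\<L>(n \<omega>\<^sub>r)\<^sup>m\<close>.\<close>

definition invariant_section ::
  "nat \<Rightarrow> nat \<Rightarrow> complex mat set set \<Rightarrow> complex mat set set set \<Rightarrow>
   ((nat set \<Rightarrow> complex) \<Rightarrow> complex) \<Rightarrow> bool" where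
  "invariant_section n r H Y s \<longleftrightarrow>
     (\<forall>A\<in>carrier (SL n). proj n A \<in> H \<longrightarrow> (\<forall>v\<in>cone n r Y. s (ext_act n r A v) = s v))"

text \<open>Points of \<open>Y\<close> that are semistable for the action of \<open>H\<close> with respect to \<open>\<L>(n \<omega>\<^sub>r) = \<O>(n)\<close>.\<close>

definition semistable ::
  "nat \<Rightarrow> nat \<Rightarrow> complex mat set set \<Rightarrow> complex mat set set set \<Rightarrow> complex mat set set set" where
  "semistable n r H Y = {y \<in> Y. \<exists>m>0. \<exists>s\<in>sections_O n r Y (n * m).
     invariant_section n r H Y s \<and> (\<forall>v\<in>cone n r {y}. s v \<noteq> 0)}"

end

theory Submission
  imports Defs
begin

text \<open>
  Number rows from \<open>0\<close> and cut \<open>{0, \<dots>, n - 1}\<close> into the blocks \<open>{b q, \<dots>, b q + q - 1}\<close> for \<open>b < r\<close>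
  and the last block \<open>{r q}\<close>; the block of a row \<open>i\<close> is \<open>i div q\<close>. The elements of \<open>T\<^sub>J\<close> are
  represented by diagonal matrices that are constant on blocks (\<open>T_J_block_scalar\<close>). The point \<open>u w P\<close> is the column
  span of an \<open>n \<times> r\<close> matrix \<open>M\<close> whose column \<open>k\<close> has the entry \<open>1\<close> in the pivot row \<open>(k + 1) q\<close> and
  above it, in the rows \<open>i - 1\<close> for \<open>i\<close> in \<open>C\<^sub>k\<^sub>+\<^sub>1\<close>, the parameters of the root group factors of \<open>u\<close>;
  all other entries are \<open>0\<close>, and so every row \<open>l q\<close> with \<open>1 \<le> l \<le> r\<close> has a \<open>1\<close> as its only
  nonzero entry (\<open>cell_column_entries\<close>, \<open>cell_entry_pivot_row\<close>). A parameter is zero if and only if the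
  corresponding coordinate \<open>X\<^sub>\<beta>\<close> is zero (\<open>X_beta_eq_0_iff\<close>).

  Suppose that every column has a nonzero entry besides its pivot. Then for each block \<open>m\<close> there is a
  set \<open>I\<^sub>m\<close> consisting of one row from every block except \<open>m\<close> such that the rows of \<open>M\<close> in \<open>I\<^sub>m\<close> are
  linearly independent (\<open>transversal_omitting_block\<close>). Hence the monomial of degree \<open>n\<close>

    \<open>p(I\<^sub>0) \<cdots> p(I\<^sub>r\<^sub>-\<^sub>1) p(I\<^sub>r)\<^sup>n\<^sup>-\<^sup>r\<close>

  in the Pluecker coordinates does not vanish at \<open>u w P\<close>. In it each of the first \<open>r\<close> blocks occurs
  \<open>n - 1 = r q\<close> times and the last one occurs \<open>r\<close> times, that is, \<open>r\<close> times the size of the block, so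
  that a block scalar matrix \<open>D\<close> multiplies it by \<open>det D\<^sup>r = 1\<close> (\<open>block_scalar_monomial_invariant\<close>).

  Suppose on the other hand that the only nonzero entry of column \<open>j - 1\<close> is its pivot, which lies in
  block \<open>j\<close>. Let \<open>b\<close> be the size of that block and let the one-parameter subgroup \<open>D\<close> of \<open>T\<^sub>J\<close> act by
  \<open>z\<^sup>n\<^sup>-\<^sup>b\<close> on the block and by \<open>z\<^sup>-\<^sup>b\<close> on all other rows. Up to rescaling columns, \<open>D(z)\<close> multiplies by
  \<open>z\<^sup>n\<close> the entries of \<open>M\<close> in block \<open>j\<close> outside column \<open>j - 1\<close>. So \<open>D(z)\<close> moves the vector \<open>v\<close> of
  Pluecker coordinates to \<open>z\<^sup>N v'(z)\<close>, where \<open>N = n - b r > 0\<close> and \<open>v'(z)\<close> converges, as \<open>z \<rightarrow> 0\<close>,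
  to a nonzero vector that still lies over the open cell (\<open>ext_act_cell_vector\<close>,
  \<open>cell_vector_scaled_tendsto\<close>). An invariant section \<open>s\<close> of positive degree therefore satisfies
  \<open>s(v) = s(z\<^sup>N v'(z)) \<rightarrow> 0\<close>, which means \<open>s(v) = 0\<close> (\<open>invariant_section_vanishes\<close>).
\<close>

section \<open>The groups SL and PSL\<close>

lemma SL_sel [simp]:
  "carrier (SL n) = {A \<in> carrier_mat n n. det A = 1}"
  "monoid.mult (SL n) = (*)" "one (SL n) = 1\<^sub>m n"
  by (simp_all add: SL_def)

lemma group_SL: "group (SL n)"
proof (rule groupI)
  fix A assume "A \<in> carrier (SL n)"
  hence A: "A \<in> carrier_mat n n" "det A = 1" by auto
  have "A \<in> Units (ring_mat TYPE(complex) n ())"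
    by (rule det_non_zero_imp_unit) (use A in auto)
  then obtain B where B: "B \<in> carrier_mat n n" "B * A = 1\<^sub>m n"
    by (auto simp: Units_def ring_mat_def)
  have "det B * det A = 1" using det_mult[OF B(1) A(1)] B(2) by simp
  thus "\<exists>B\<in>carrier (SL n). B \<otimes>\<^bsub>SL n\<^esub> A = \<one>\<^bsub>SL n\<^esub>" using A B by auto
qed (auto simp: det_mult[of _ n])

text \<open>Comparing entries in \<open>Z E = E Z\<close> for the transvections \<open>E\<close> already forces \<open>Z\<close> to be scalar.\<close>

lemma SL_center_eq: "SL_center n = {\<zeta> \<cdot>\<^sub>m 1\<^sub>m n | \<zeta>. \<zeta> ^ n = 1}"
proof safe
  fix \<zeta> :: complex assume z: "\<zeta> ^ n = 1"
  have "\<zeta> \<cdot>\<^sub>m 1\<^sub>m n * A = A * (\<zeta> \<cdot>\<^sub>m 1\<^sub>m n)" if "A \<in> carrier_mat n n" for A :: "complex mat"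
    using that by (simp add: mult_smult_assoc_mat[of _ n n _ n] mult_smult_distrib[of _ n n _ n])
  thus "\<zeta> \<cdot>\<^sub>m 1\<^sub>m n \<in> SL_center n" using z by (auto simp: SL_center_def)
next
  fix Z assume "Z \<in> SL_center n"
  hence Z: "Z \<in> carrier_mat n n" "det Z = 1"
    and comm: "\<And>A. A \<in> carrier_mat n n \<Longrightarrow> det A = 1 \<Longrightarrow> Z * A = A * Z"
    by (auto simp: SL_center_def)
  have off: "Z $$ (i, k) = (if i = k then Z $$ (l, l) else 0)"
    if "i < n" "k < n" "l < n" "k \<noteq> l" for i k l
  proof -
    let ?E = "addrow_mat n (1 :: complex) k l"
    have e: "Z * ?E = ?E * Z" using that by (intro comm) (auto simp: det_addrow_mat)
    have "(Z * ?E) $$ (i, l) = (\<Sum>t<n. Z $$ (i, t) * ?E $$ (t, l))"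
      using that Z by (simp add: scalar_prod_def atLeast0LessThan)
    also have "\<dots> = (\<Sum>t<n. (if t = k then Z $$ (i, t) else 0) + (if t = l then Z $$ (i, t) else 0))"
      using that by (intro sum.cong) auto
    also have "\<dots> = Z $$ (i, k) + Z $$ (i, l)"
      using that by (simp add: sum.distrib)
    finally have a: "(Z * ?E) $$ (i, l) = Z $$ (i, k) + Z $$ (i, l)" .
    have "(?E * Z) $$ (i, l) = (if k = i then Z $$ (l, l) + Z $$ (i, l) else Z $$ (i, l))"
      using that Z by (subst addrow_mat[symmetric, of _ _ n]) auto
    with a show ?thesis unfolding e by auto
  qed
  define \<zeta> where "\<zeta> = Z $$ (0, 0)"
  have "Z $$ (i, j) = (if i = j then \<zeta> else 0)" if "i < n" "j < n" for i j
  proof (cases "i = j")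
    case False
    with off[of i j i] that show ?thesis by auto
  next
    case True
    with off[of i i 0] that show ?thesis by (cases "i = 0") (auto simp: \<zeta>_def)
  qed
  hence Ze: "Z = \<zeta> \<cdot>\<^sub>m 1\<^sub>m n" using Z by (intro eq_matI) auto
  moreover from this Z have "\<zeta> ^ n = 1" by simp
  ultimately show "\<exists>\<zeta>. Z = \<zeta> \<cdot>\<^sub>m 1\<^sub>m n \<and> \<zeta> ^ n = 1" by blast
qed

lemma smult_twice: "a \<cdot>\<^sub>m (b \<cdot>\<^sub>m A) = (a * b :: complex) \<cdot>\<^sub>m A"
  by (rule eq_matI) auto

lemma SL_center_normal: "SL_center n \<lhd> SL n"
proof -
  interpret group "SL n" by (rule group_SL)
  have sub: "subgroup (SL_center n) (SL n)"
  proof (rule subgroupI)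
    show "SL_center n \<subseteq> carrier (SL n)" by (auto simp: SL_center_def)
    show "SL_center n \<noteq> {}" by (auto simp: SL_center_eq intro: exI[of _ 1])
  next
    fix Y Z assume YZ: "Y \<in> SL_center n" "Z \<in> SL_center n"
    then obtain a b where "Y = a \<cdot>\<^sub>m 1\<^sub>m n" "Z = b \<cdot>\<^sub>m 1\<^sub>m n" "a ^ n = 1" "b ^ n = 1"
      by (auto simp: SL_center_eq)
    hence "Y * Z = (a * b) \<cdot>\<^sub>m 1\<^sub>m n" "(a * b) ^ n = 1"
      by (auto simp: mult_smult_assoc_mat[of _ n n _ n] power_mult_distrib smult_twice)
    thus "Y \<otimes>\<^bsub>SL n\<^esub> Z \<in> SL_center n" by (auto simp: SL_center_eq)
  next
    fix Z assume "Z \<in> SL_center n"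
    then obtain b where b: "Z = b \<cdot>\<^sub>m 1\<^sub>m n" "b ^ n = 1"
      by (auto simp: SL_center_eq)
    have "inverse b \<cdot>\<^sub>m 1\<^sub>m n * Z = (inverse b * b) \<cdot>\<^sub>m 1\<^sub>m n"
      unfolding b by (auto simp: mult_smult_assoc_mat[of _ n n _ n] smult_twice)
    also have "\<dots> = 1\<^sub>m n"
      using b(2) by (intro eq_matI) (cases "b = 0"; auto simp: power_0_left split: if_splits)+
    finally have "inv\<^bsub>SL n\<^esub> Z = inverse b \<cdot>\<^sub>m 1\<^sub>m n"
      using b by (intro inv_equality) (auto simp: power_inverse)
    thus "inv\<^bsub>SL n\<^esub> Z \<in> SL_center n"
      using b by (auto simp: SL_center_eq power_inverse intro!: exI[of _ "inverse b"])
  qed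
  show ?thesis
  proof (rule normal_invI[OF sub])
    fix A Z assume A: "A \<in> carrier (SL n)" and Z: "Z \<in> SL_center n"
    hence Zc: "Z \<in> carrier (SL n)" by (auto simp: SL_center_def)
    have "A \<otimes>\<^bsub>SL n\<^esub> Z = Z \<otimes>\<^bsub>SL n\<^esub> A" using A Z by (auto simp: SL_center_def)
    hence "A \<otimes>\<^bsub>SL n\<^esub> Z \<otimes>\<^bsub>SL n\<^esub> inv\<^bsub>SL n\<^esub> A = Z"
      using A Zc by (metis inv_solve_right' m_closed)
    thus "A \<otimes>\<^bsub>SL n\<^esub> Z \<otimes>\<^bsub>SL n\<^esub> inv\<^bsub>SL n\<^esub> A \<in> SL_center n" using Z by simp
  qed
qed

lemma group_PSL: "group (PSL n)"
  unfolding PSL_def by (rule normal.factorgroup_is_group[OF SL_center_normal])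

lemma carrier_PSL: "carrier (PSL n) = proj n ` carrier (SL n)"
  unfolding PSL_def carrier_FactGroup proj_def ..

lemma proj_closed: "A \<in> carrier (SL n) \<Longrightarrow> proj n A \<in> carrier (PSL n)"
  by (auto simp: carrier_PSL)

lemma proj_mult:
  "A \<in> carrier (SL n) \<Longrightarrow> B \<in> carrier (SL n) \<Longrightarrow>
   proj n A \<otimes>\<^bsub>PSL n\<^esub> proj n B = proj n (A * B)"
  unfolding PSL_def proj_def using normal.rcos_sum[OF SL_center_normal, of A n B] by simp

lemma mem_proj_iff:
  assumes "A \<in> carrier (SL n)"
  shows "B \<in> proj n A \<longleftrightarrow> (\<exists>\<zeta>. \<zeta> ^ n = 1 \<and> B = \<zeta> \<cdot>\<^sub>m A)"
proof -
  have "\<zeta> \<cdot>\<^sub>m 1\<^sub>m n * A = \<zeta> \<cdot>\<^sub>m A" for \<zeta>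
    using assms by (auto simp: mult_smult_assoc_mat[of _ n n _ n] left_mult_one_mat)
  thus ?thesis by (auto simp: proj_def r_coset_def SL_center_eq)
qed

lemma proj_self: "A \<in> carrier (SL n) \<Longrightarrow> A \<in> proj n A"
  by (auto simp: mem_proj_iff intro!: exI[of _ 1])

lemma proj_eq_iff:
  assumes "A \<in> carrier (SL n)" "B \<in> carrier (SL n)"
  shows "proj n A = proj n B \<longleftrightarrow> (\<exists>\<zeta>. \<zeta> ^ n = 1 \<and> A = \<zeta> \<cdot>\<^sub>m B)"
proof
  assume "proj n A = proj n B"
  hence "A \<in> proj n B" using proj_self[OF assms(1)] by simp
  thus "\<exists>\<zeta>. \<zeta> ^ n = 1 \<and> A = \<zeta> \<cdot>\<^sub>m B" using assms by (simp add: mem_proj_iff)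
next
  assume "\<exists>\<zeta>. \<zeta> ^ n = 1 \<and> A = \<zeta> \<cdot>\<^sub>m B"
  hence "A \<in> SL_center n #>\<^bsub>SL n\<^esub> B"
    using assms by (simp flip: proj_def add: mem_proj_iff)
  thus "proj n A = proj n B"
    unfolding proj_def
    using group.repr_independence[OF group_SL _ assms(2) normal_imp_subgroup[OF SL_center_normal]]
    by simp
qed

lemma proj_one: "proj n (1\<^sub>m n) = \<one>\<^bsub>PSL n\<^esub>"
proof -
  have "\<zeta> \<cdot>\<^sub>m 1\<^sub>m n * 1\<^sub>m n = \<zeta> \<cdot>\<^sub>m 1\<^sub>m n" for \<zeta> :: complex
    by (simp add: right_mult_one_mat[of _ n])
  thus ?thesis by (auto simp: PSL_def proj_def r_coset_def SL_center_eq)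
qed

lemma SL_mult: "A \<in> carrier (SL n) \<Longrightarrow> B \<in> carrier (SL n) \<Longrightarrow> A * B \<in> carrier (SL n)"
  using monoid.m_closed[OF group.is_monoid[OF group_SL]] by fastforce

lemma SL_foldr_closed:
  "set As \<subseteq> carrier (SL n) \<Longrightarrow> foldr (*) As (1\<^sub>m n) \<in> carrier (SL n)"
  by (induction As) (auto simp: det_mult[of _ n])

lemma mult_list_proj:
  "set As \<subseteq> carrier (SL n) \<Longrightarrow> mult_list (PSL n) (map (proj n) As) = proj n (foldr (*) As (1\<^sub>m n))"
proof (induction As)
  case Nil
  thus ?case by (simp add: mult_list_def proj_one)
next
  case (Cons A As)
  thus ?case using proj_mult[of A n "foldr (*) As (1\<^sub>m n)"] SL_foldr_closed[of As n]
    by (simp add: mult_list_def)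
qed

lemma proj_transvection_eq_iff:
  assumes "k \<noteq> l" "k < n" "l < n"
  shows "proj n (addrow_mat n a k l) = proj n (addrow_mat n b k l) \<longleftrightarrow> a = b"
proof
  have SL: "addrow_mat n c k l \<in> carrier (SL n)" for c :: complex
    using assms by (auto simp: det_addrow_mat)
  assume "proj n (addrow_mat n a k l) = proj n (addrow_mat n b k l)"
  then obtain \<zeta> where "addrow_mat n a k l = \<zeta> \<cdot>\<^sub>m addrow_mat n b k l"
    using proj_eq_iff[OF SL SL] by blast
  hence *: "addrow_mat n a k l $$ (i, j) = \<zeta> * addrow_mat n b k l $$ (i, j)" if "i < n" "j < n" for i j
    using that by simp
  show "a = b" using *[of l l] *[of k l] assms by simp
qed simp

section \<open>The torus and its one-parameter subgroups\<close>

lemma det_mat_diag: "det (mat_diag n d) = (\<Prod>i<n. d i)" for d :: "nat \<Rightarrow> complex"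
proof -
  have "det (mat_diag n d) = prod_list (diag_mat (mat_diag n d))"
    by (rule det_upper_triangular[of _ n]) (auto simp: mat_diag_def)
  thus ?thesis
    by (simp add: prod_list_diag_prod mat_diag_def atLeast0LessThan)
qed

lemma mat_diag_SL_iff: "mat_diag n d \<in> carrier (SL n) \<longleftrightarrow> (\<Prod>i<n. d i) = 1"
  by (simp add: det_mat_diag)

lemma torus_eq: "torus n = {proj n (mat_diag n d) | d. (\<Prod>i<n. d i) = 1}"
proof safe
  fix t assume "t \<in> torus n"
  then obtain A where A: "A \<in> carrier (SL n)" "diagonal_mat A" "t = proj n A"
    by (auto simp: torus_def)
  hence "A = mat_diag n (\<lambda>i. A $$ (i, i))"
    by (intro eq_matI) (auto simp: mat_diag_def diagonal_mat_def)
  thus "\<exists>d. t = proj n (mat_diag n d) \<and> (\<Prod>i<n. d i) = 1"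
    using A mat_diag_SL_iff by metis
next
  fix d :: "nat \<Rightarrow> complex" assume "(\<Prod>i<n. d i) = 1"
  hence "mat_diag n d \<in> carrier (SL n)" unfolding mat_diag_SL_iff .
  moreover have "diagonal_mat (mat_diag n d)" by (auto simp: diagonal_mat_def mat_diag_def)
  ultimately show "proj n (mat_diag n d) \<in> torus n" unfolding torus_def by blast
qed

lemma simple_root_diag:
  assumes "(\<Prod>i<n. d i) = 1" "i \<in> {1..<n}"
  shows "simple_root i (proj n (mat_diag n d)) = d (i - 1) / d i"
proof -
  have SL: "mat_diag n d \<in> carrier (SL n)" using assms(1) unfolding mat_diag_SL_iff .
  have val: "A $$ (i - 1, i - 1) / A $$ (i, i) = d (i - 1) / d i" if A: "A \<in> proj n (mat_diag n d)" for A
  proof -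
    obtain \<zeta> where "\<zeta> ^ n = 1" "A = \<zeta> \<cdot>\<^sub>m mat_diag n d"
      using A unfolding mem_proj_iff[OF SL] by auto
    moreover from this assms have "\<zeta> \<noteq> 0" by (auto simp: power_0_left)
    moreover have "i - 1 < n" "i < n" using assms(2) by auto
    ultimately show ?thesis by (simp add: mat_diag_def)
  qed
  show ?thesis unfolding simple_root_def
    using val proj_self[OF SL] by (intro the_equality) metis+
qed

lemma diag_determined_by_roots:
  fixes d e :: "nat \<Rightarrow> complex"
  assumes "\<And>i. i \<in> {1..<n} \<Longrightarrow> d (i - 1) / d i = e (i - 1) / e i"
    and "\<And>i. i < n \<Longrightarrow> d i \<noteq> 0" "\<And>i. i < n \<Longrightarrow> e i \<noteq> 0" and "i < n"
  shows "e i = e 0 / d 0 * d i"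
  using \<open>i < n\<close>
proof (induction i)
  case 0
  thus ?case using assms(2)[of 0] by simp
next
  case (Suc i)
  hence IH: "e i = e 0 / d 0 * d i" by simp
  have step: "d i / d (Suc i) = e i / e (Suc i)" using assms(1)[of "Suc i"] Suc by simp
  have nz: "d i \<noteq> 0" "e i \<noteq> 0" "d (Suc i) \<noteq> 0" "e (Suc i) \<noteq> 0"
    using assms(2,3) Suc.prems by auto
  have "e (Suc i) = e i / d i * d (Suc i)" using step nz by (simp add: field_simps)
  also have "e i / d i = e 0 / d 0" using IH nz by simp
  finally show ?case .
qed

text \<open>The quotients of consecutive diagonal entries determine a diagonal matrix up to a scalar, and a scalar
  of determinant \<open>1\<close> is central. This gives the uniqueness behind the definite description in
  \<open>dual_cochar\<close>.\<close>

lemma dual_cochar_eq: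
  assumes "(\<Prod>i<n. d i) = 1"
    and "\<And>i. i \<in> {1..<n} \<Longrightarrow> d (i - 1) = (if i = k then z else 1) * d i"
  shows "dual_cochar n k z = proj n (mat_diag n d)"
  unfolding dual_cochar_def
proof (rule the_equality)
  have nz: "d i \<noteq> 0" if "i < n" for i
    using assms(1) that by (metis finite_lessThan lessThan_iff prod_zero zero_neq_one)
  show "proj n (mat_diag n d) \<in> torus n \<and>
    (\<forall>i\<in>{1..<n}. simple_root i (proj n (mat_diag n d)) = (if i = k then z else 1))"
    using assms nz by (auto simp: torus_eq simple_root_diag)
  fix t assume t: "t \<in> torus n \<and> (\<forall>i\<in>{1..<n}. simple_root i t = (if i = k then z else 1))"
  then obtain e where e: "t = proj n (mat_diag n e)" "(\<Prod>i<n. e i) = 1" by (auto simp: torus_eq)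
  have nze: "e i \<noteq> 0" if "i < n" for i
    using e(2) that by (metis finite_lessThan lessThan_iff prod_zero zero_neq_one)
  have "d (i - 1) / d i = e (i - 1) / e i" if "i \<in> {1..<n}" for i
  proof -
    have "e (i - 1) / e i = (if i = k then z else 1)"
      using t e that by (auto simp: simple_root_diag)
    thus ?thesis using assms(2)[OF that] nz[of i] that by simp
  qed
  hence ed: "e i = e 0 / d 0 * d i" if "i < n" for i
    by (rule diag_determined_by_roots) (use nz nze that in auto)
  have "(\<Prod>i<n. e i) = (\<Prod>i<n. e 0 / d 0 * d i)"
    by (intro prod.cong refl ed) auto
  also have "\<dots> = (e 0 / d 0) ^ n * (\<Prod>i<n. d i)"
    by (simp only: prod.distrib prod_constant card_lessThan)
  finally have "(e 0 / d 0) ^ n = 1" using e assms by simp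
  moreover have "mat_diag n e = (e 0 / d 0) \<cdot>\<^sub>m mat_diag n d"
  proof (rule eq_matI)
    fix i j assume "i < dim_row ((e 0 / d 0) \<cdot>\<^sub>m mat_diag n d)" "j < dim_col ((e 0 / d 0) \<cdot>\<^sub>m mat_diag n d)"
    hence "i < n" "j < n" by (auto simp: mat_diag_def)
    thus "mat_diag n e $$ (i, j) = ((e 0 / d 0) \<cdot>\<^sub>m mat_diag n d) $$ (i, j)"
      using ed[of j] by (cases "i = j") (auto simp: mat_diag_def)
  qed (auto simp: mat_diag_def)
  ultimately show "t = proj n (mat_diag n d)"
    unfolding e(1)
    using proj_eq_iff[OF iffD2[OF mat_diag_SL_iff e(2)] iffD2[OF mat_diag_SL_iff assms(1)]] by blast
qed

lemma prod_two_step: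
  fixes y z :: complex
  assumes "k \<le> n"
  shows "(\<Prod>i<n. if i < k then y * z else y) = y ^ n * z ^ k"
proof -
  have "(\<Prod>i<n. if i < k then y * z else y) = (\<Prod>i<n. y * (if i < k then z else 1))"
    by (intro prod.cong) auto
  also have "\<dots> = y ^ n * (\<Prod>i\<in>{..<n} \<inter> {i. i < k}. z)"
    by (simp add: prod.distrib prod.If_cases)
  also have "{..<n} \<inter> {i. i < k} = {..<k}" using assms by auto
  finally show ?thesis by simp
qed

text \<open>An explicit representative of \<open>\<lambda>\<^sub>k(z)\<close>: it is \<open>y \<cdot> diag(z, \<dots>, z, 1, \<dots>, 1)\<close>, where the root \<open>y\<close>
  normalizes the determinant.\<close>

lemma dual_cochar_two_step:
  assumes "1 \<le> k" "k < n" "y ^ n * z ^ k = 1"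
  shows "(\<Prod>i<n. if i < k then y * z else y) = 1"
    and "dual_cochar n k z = proj n (mat_diag n (\<lambda>i. if i < k then y * z else y))"
proof -
  show 1: "(\<Prod>i<n. if i < k then y * z else y) = 1" using assms by (subst prod_two_step) auto
  show "dual_cochar n k z = proj n (mat_diag n (\<lambda>i. if i < k then y * z else y))"
    by (rule dual_cochar_eq[OF 1]) (use assms in auto)
qed

lemma prod_blocks:
  fixes d :: "nat \<Rightarrow> complex"
  assumes "q > 0"
  shows "(\<Prod>i<r*q+1. d (i div q)) = (\<Prod>b<r. d b) ^ q * d r"
proof -
  have "(\<Prod>i<r*q. d (i div q)) = (\<Prod>b<r. \<Prod>i=b*q..<b*q+q. d (i div q))"
    by (rule prod.nat_group[symmetric])
  also have "\<dots> = (\<Prod>b<r. \<Prod>i=b*q..<b*q+q. d b)"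
    by (intro prod.cong refl arg_cong[where f = d] div_nat_eqI) (auto simp: algebra_simps)
  also have "\<dots> = (\<Prod>b<r. d b) ^ q" by (simp add: prod_power_distrib)
  finally have "(\<Prod>i<r*q. d (i div q)) = (\<Prod>b<r. d b) ^ q" .
  moreover have "{..<r*q+1} = insert (r*q) {..<r*q}" by auto
  ultimately show ?thesis using assms by (simp add: mult.commute)
qed

lemma block_diag_SL:
  assumes "(\<Prod>b<r. d b) ^ q * d r = 1" "n = r * q + 1" "q \<ge> 1"
  shows "mat_diag n (\<lambda>i. d (i div q)) \<in> carrier (SL n)"
  unfolding mat_diag_SL_iff assms(2) using prod_blocks[of q d r] assms(1,3) by simp

lemma T_J_block_scalar:
  assumes "t \<in> T_J n r q" "n = r * q + 1" "q \<ge> 1"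
  shows "\<exists>d. (\<Prod>b<r. d b) ^ q * d r = 1 \<and> t = proj n (mat_diag n (\<lambda>i. d (i div q)))"
  using assms(1) unfolding T_J_def
proof (induction rule: generate.induct)
  case one
  show ?case using assms by (intro exI[of _ "\<lambda>_. 1"]) (simp add: proj_one)
next
  have *: "\<exists>d. (\<Prod>b<r. d b) ^ q * d r = 1 \<and> h = proj n (mat_diag n (\<lambda>i. d (i div q)))"
    if "h \<in> (\<Union>j\<in>{1..r}. dual_cochar n (j * q) ` (UNIV - {0}))" for h
  proof -
    from that obtain j z where jz: "j \<in> {1..r}" "z \<noteq> 0" "h = dual_cochar n (j * q) z" by blast
    have "card {y::complex. y ^ n = inverse z ^ (j * q)} = n"
      using jz assms by (intro card_nth_roots) auto
    hence "{y::complex. y ^ n = inverse z ^ (j * q)} \<noteq> {}" using assms by (intro notI) simp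
    then obtain y where "y ^ n = inverse z ^ (j * q)" by blast
    hence y: "y ^ n * z ^ (j * q) = 1" using jz by (simp add: power_inverse)
    have jq: "1 \<le> j * q" "j * q < n" using jz assms mult_le_mono1[of j r q] by (auto simp: less_Suc_eq_le)
    note two = dual_cochar_two_step[OF jq y]
    let ?d = "\<lambda>b. if b < j then y * z else y"
    have blk: "?d (i div q) = (if i < j * q then y * z else y)" for i
      using assms by (simp add: div_less_iff_less_mult)
    have "(\<Prod>b<r. ?d b) ^ q * ?d r = (\<Prod>i<n. ?d (i div q))"
      unfolding assms(2) using assms by (intro prod_blocks[symmetric]) auto
    also have "\<dots> = 1" unfolding blk by (rule two(1))
    finally show ?thesis unfolding jz(3) two(2) blk[symmetric] by (intro exI[of _ ?d] conjI refl)
  qed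
  {
    case (incl h)
    thus ?case by (rule *)
  next
    case (inv h)
    from *[OF inv] obtain d where d: "(\<Prod>b<r. d b) ^ q * d r = 1"
      "h = proj n (mat_diag n (\<lambda>i. d (i div q)))" by auto
    let ?e = "\<lambda>i. inverse (d i)"
    have e: "(\<Prod>b<r. ?e b) ^ q * ?e r = 1"
      using d(1) prod_inversef[of d "{..<r}"]
      by (simp only: comp_def power_inverse flip: inverse_mult_distrib) simp
    have SL: "mat_diag n (\<lambda>i. d (i div q)) \<in> carrier (SL n)"
             "mat_diag n (\<lambda>i. ?e (i div q)) \<in> carrier (SL n)"
      by (intro block_diag_SL[OF _ assms(2,3)] d e)+
    have nz: "d (i div q) \<noteq> 0" if "i < n" for i
      using SL(1) that unfolding mat_diag_SL_iff
      by (metis (no_types, lifting) finite_lessThan lessThan_iff prod_zero zero_neq_one)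
    have "mat_diag n (\<lambda>i. ?e (i div q)) * mat_diag n (\<lambda>i. d (i div q)) = 1\<^sub>m n"
      unfolding mat_diag_diag using nz by (intro eq_matI) (auto simp: mat_diag_def)
    hence "proj n (mat_diag n (\<lambda>i. ?e (i div q))) \<otimes>\<^bsub>PSL n\<^esub> h = \<one>\<^bsub>PSL n\<^esub>"
      unfolding d(2) using SL by (subst proj_mult) (simp_all add: proj_one)
    hence "inv\<^bsub>PSL n\<^esub> h = proj n (mat_diag n (\<lambda>i. ?e (i div q)))"
      unfolding d(2) by (intro group.inv_equality[OF group_PSL] proj_closed SL)
    thus ?case using e by (intro exI[of _ ?e]) auto
  next
    case (eng h1 h2)
    then obtain d e where de: "(\<Prod>b<r. d b) ^ q * d r = 1"
      "h1 = proj n (mat_diag n (\<lambda>i. d (i div q)))" "(\<Prod>b<r. e b) ^ q * e r = 1"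
      "h2 = proj n (mat_diag n (\<lambda>i. e (i div q)))" by auto
    have SL: "mat_diag n (\<lambda>i. d (i div q)) \<in> carrier (SL n)"
             "mat_diag n (\<lambda>i. e (i div q)) \<in> carrier (SL n)"
      by (intro block_diag_SL[OF _ assms(2,3)] de)+
    have "(\<Prod>b<r. d b * e b) ^ q * (d r * e r)
        = ((\<Prod>b<r. d b) ^ q * d r) * ((\<Prod>b<r. e b) ^ q * e r)"
      by (simp add: prod.distrib power_mult_distrib)
    thus ?case unfolding de(2,4) proj_mult[OF SL]
      using de by (intro exI[of _ "\<lambda>i. d i * e i"]) simp
  }
qed

lemma power_power_cancel:
  fixes a b :: complex
  assumes "a * b = 1"
  shows "(a ^ m) ^ k * (b ^ k) ^ m = 1"
proof -
  have "(a ^ m) ^ k * (b ^ k) ^ m = (a * b) ^ (m * k)"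
    by (metis power_mult mult.commute power_mult_distrib)
  thus ?thesis using assms by simp
qed

text \<open>The one-parameter subgroup that singles out block \<open>j\<close>. It is
  \<open>\<lambda>\<^sub>(\<^sub>j\<^sub>+\<^sub>1\<^sub>)\<^sub>q(z\<^sup>n) \<lambda>\<^sub>j\<^sub>q(z\<^sup>-\<^sup>n)\<close>, without the first factor when \<open>j = r\<close>; the exponent \<open>n\<close> makes
  the normalizing \<open>n\<close>-th roots powers of \<open>z\<close>.\<close>

lemma T_J_one_block:
  assumes "j \<in> {1..r}" "n = r * q + 1" "q \<ge> 1" "z \<noteq> 0"
  defines "b \<equiv> (if j = r then 1 else q)"
  shows "(\<Prod>i<n. inverse z ^ b * (if i div q = j then z ^ n else 1)) = 1" (is ?P)
    and "proj n (mat_diag n (\<lambda>i. inverse z ^ b * (if i div q = j then z ^ n else 1))) \<in> T_J n r q"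
      (is ?Q)
proof -
  have blk: "i div q < l \<longleftrightarrow> i < l * q" for i l
    using assms by (intro div_less_iff_less_mult) auto
  have jq: "1 \<le> j * q" "j * q < n" using assms mult_le_mono1[of j r q] by (auto simp: less_Suc_eq_le)
  have gen: "dual_cochar n (l * q) y \<in> T_J n r q" if "l \<in> {1..r}" "y \<noteq> 0" for l y
    using that unfolding T_J_def by (intro generate.incl) blast
  \<comment> \<open>for \<open>\<lambda>\<^sub>j\<^sub>q(z\<^sup>-\<^sup>n)\<close>\<close>
  have y2: "(z ^ (j * q)) ^ n * (inverse z ^ n) ^ (j * q) = 1"
    using assms(4) by (intro power_power_cancel) simp
  note two2 = dual_cochar_two_step[OF jq y2]
  show ?P ?Q
  proof -
    have "?P \<and> ?Q"
    proof (cases "j = r")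
      case True
      have eq: "(if i < j * q then z ^ (j * q) * inverse z ^ n else z ^ (j * q))
          = inverse z ^ b * (if i div q = j then z ^ n else 1)" if "i < n" for i
      proof -
        have "z ^ n = z * z ^ (j * q)" using assms(2) True by simp
        moreover have "i div q = j \<longleftrightarrow> \<not> i < j * q"
          using blk[of i j] blk[of i "Suc j"] that assms(2,3) True by auto
        ultimately show ?thesis using assms(4) True by (simp add: b_def field_simps)
      qed
      hence "(\<Prod>i<n. if i < j * q then z ^ (j * q) * inverse z ^ n else z ^ (j * q)) = (\<Prod>i<n. inverse z ^ b * (if i div q = j then z ^ n else 1))"
        by (intro prod.cong) auto
      moreover from eq have "mat_diag n (\<lambda>i. if i < j * q then z ^ (j * q) * inverse z ^ n else z ^ (j * q)) =
          mat_diag n (\<lambda>i. inverse z ^ b * (if i div q = j then z ^ n else 1))"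
        by (intro eq_matI) (auto simp: mat_diag_def)
      ultimately show ?thesis using two2 gen[of j "inverse z ^ n"] assms by auto
    next
      case False
      hence jq': "1 \<le> Suc j * q" "Suc j * q < n" using assms mult_le_mono1[of "Suc j" r q] by (auto simp: less_Suc_eq_le)
      \<comment> \<open>for \<open>\<lambda>\<^sub>(\<^sub>j\<^sub>+\<^sub>1\<^sub>)\<^sub>q(z\<^sup>n)\<close>\<close>
      have y1: "(inverse z ^ (Suc j * q)) ^ n * (z ^ n) ^ (Suc j * q) = 1"
        using assms(4) by (intro power_power_cancel) simp
      note two1 = dual_cochar_two_step[OF jq' y1]
      let ?d1 = "\<lambda>i. if i < Suc j * q then inverse z ^ (Suc j * q) * z ^ n else inverse z ^ (Suc j * q)"
      let ?d2 = "\<lambda>i. if i < j * q then z ^ (j * q) * inverse z ^ n else z ^ (j * q)"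
      have eq: "?d1 i * ?d2 i = inverse z ^ b * (if i div q = j then z ^ n else 1)" for i
      proof -
        have "i div q = j \<longleftrightarrow> \<not> i < j * q \<and> i < Suc j * q"
          using blk[of i j] blk[of i "Suc j"] by auto
        moreover have "inverse z ^ (Suc j * q) * z ^ (j * q) = inverse z ^ b"
          using assms(4) False by (simp add: b_def power_add field_simps)
        moreover have "inverse z ^ n * z ^ n = 1"
          using assms(4) by (simp flip: power_mult_distrib)
        moreover have "i < j * q \<Longrightarrow> i < Suc j * q" by simp
        ultimately show ?thesis by (auto simp: algebra_simps)
      qed
      have SL: "mat_diag n ?d1 \<in> carrier (SL n)" "mat_diag n ?d2 \<in> carrier (SL n)"
        using two1 two2 unfolding mat_diag_SL_iff by auto
      have "proj n (mat_diag n ?d1) \<otimes>\<^bsub>PSL n\<^esub> proj n (mat_diag n ?d2) \<in> T_J n r q"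
        unfolding two1(2)[symmetric] two2(2)[symmetric]
        using gen[of "Suc j" "z ^ n"] gen[of j "inverse z ^ n"] False assms
        unfolding T_J_def by (intro generate.eng) auto
      hence ?Q unfolding proj_mult[OF SL] mat_diag_diag eq .
      moreover have ?P using two1(1) two2(1) unfolding eq[symmetric] prod.distrib by simp
      ultimately show ?thesis by blast
    qed
    thus ?P ?Q by auto
  qed
qed

section \<open>The unipotent group and its coordinates\<close>

lemma C_set_Suc_iff: "Suc p \<in> C_set q j \<longleftrightarrow> p \<le> j * q \<and> (\<forall>l\<in>{1..j}. p \<noteq> l * q)"
  by (auto simp: C_set_def)

lemma C_set_pos: "i \<in> C_set q j \<Longrightarrow> i \<ge> 1"
  by (auto simp: C_set_def)

text \<open>For \<open>l \<le> j\<close> the pivot rows \<open>l q\<close> are removed from \<open>C\<^sub>j\<close> by definition, and for \<open>l > j\<close> they lie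
  beyond its largest element.\<close>

lemma C_set_not_pivot:
  assumes "Suc p \<in> C_set q j" "1 \<le> l" "q \<ge> 1"
  shows "p \<noteq> l * q"
proof (cases "l \<le> j")
  case False
  hence "j * q < l * q" using assms by simp
  thus ?thesis using assms(1) by (auto simp: C_set_Suc_iff)
qed (use assms in \<open>auto simp: C_set_Suc_iff\<close>)

lemma C_set_less: "Suc p \<in> C_set q j \<Longrightarrow> 1 \<le> j \<Longrightarrow> q \<ge> 1 \<Longrightarrow> p < j * q"
  using C_set_not_pivot[of p q j j] by (metis C_set_Suc_iff le_neq_implies_less)

text \<open>The product of the root group elements with parameters \<open>a i j\<close> for \<open>\<beta>\<^sub>i\<^sub>,\<^sub>j\<close>. The root subgroup of
  \<open>\<beta>\<^sub>i\<^sub>,\<^sub>j\<close> occupies row \<open>i - 1\<close> and column \<open>j q\<close>.\<close>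

definition cell_unipotent :: "nat \<Rightarrow> nat \<Rightarrow> nat \<Rightarrow> (nat \<Rightarrow> nat \<Rightarrow> complex) \<Rightarrow> complex mat" where
  "cell_unipotent n r q a = mat n n (\<lambda>(p, c). (if p = c then 1 else 0) +
     (if q dvd c \<and> c div q \<in> {1..r} \<and> Suc p \<in> C_set q (c div q) then a (Suc p) (c div q) else 0))"

text \<open>Column \<open>k < r\<close> is the column \<open>(k + 1) q\<close> of \<open>cell_unipotent\<close>, because \<open>w\<close> sends \<open>k\<close> to \<open>(k + 1) q\<close>.
  These columns are the reduced echelon basis of the \<open>r\<close>-dimensional subspace that is the point \<open>u w P\<close> of
  the Grassmannian.\<close>

definition cell_entry :: "nat \<Rightarrow> (nat \<Rightarrow> nat \<Rightarrow> complex) \<Rightarrow> nat \<Rightarrow> nat \<Rightarrow> complex" where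
  "cell_entry q a p k = (if p = Suc k * q then 1
     else if Suc p \<in> C_set q (Suc k) then a (Suc p) (Suc k) else 0)"

text \<open>The target of a transvection in the list is never the source of another one, because sources are
  pivots and targets are not. So the entries just accumulate, without cross terms.\<close>

lemma foldr_transvections:
  assumes "n = r * q + 1" "q \<ge> 1"
  assumes "set L \<subseteq> {(i, j). j \<in> {1..r} \<and> i \<in> C_set q j}" "distinct L"
  shows "foldr (*) (map (\<lambda>(i, j). addrow_mat n (a i j :: complex) (i - 1) (j * q)) L) (1\<^sub>m n) =
    mat n n (\<lambda>(p, c). (if p = c then 1 else 0) +
      (if q dvd c \<and> (Suc p, c div q) \<in> set L then a (Suc p) (c div q) else 0))"
  using assms(3,4)
proof (induction L)
  case Nil
  show ?case by (rule eq_matI) auto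
next
  case (Cons ij L)
  obtain i j where ij: "ij = (i, j)" by force
  define Y where "Y = mat n n (\<lambda>(p, c). (if p = c then 1 else 0) +
      (if q dvd c \<and> (Suc p, c div q) \<in> set L then a (Suc p) (c div q) else (0 :: complex)))"
  have IH: "foldr (*) (map (\<lambda>(i, j). addrow_mat n (a i j) (i - 1) (j * q)) L) (1\<^sub>m n) = Y"
    using Cons unfolding Y_def by simp
  have j: "j \<in> {1..r}" and i: "i \<in> C_set q j" and new: "(i, j) \<notin> set L"
    using Cons.prems ij by auto
  have jq: "j * q < n" using j assms(1) mult_le_mono1[of j r q] by (auto simp: less_Suc_eq_le)
  have Yc: "Y \<in> carrier_mat n n" by (simp add: Y_def)
  \<comment> \<open>no factor changes the pivot row \<open>j q\<close>, which is the row that is added\<close>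
  have nin: "(Suc (j * q), l) \<notin> set L" for l
    using Cons.prems(1) j C_set_not_pivot[of "j * q" q l j] assms(2) by fastforce
  have piv: "Y $$ (j * q, c) = (if c = j * q then 1 else 0)" if "c < n" for c
    using that jq nin by (simp add: Y_def)
  have "foldr (*) (map (\<lambda>(i, j). addrow_mat n (a i j) (i - 1) (j * q)) (ij # L)) (1\<^sub>m n) =
        addrow (a i j) (i - 1) (j * q) Y"
    unfolding ij by (simp add: IH addrow_mat[OF Yc jq] del: One_nat_def)
  also have "\<dots> = mat n n (\<lambda>(p, c). (if p = c then 1 else 0) +
      (if q dvd c \<and> (Suc p, c div q) \<in> set (ij # L) then a (Suc p) (c div q) else 0))"
  proof (rule eq_matI, goal_cases)
    case (1 p c)
    hence pc: "p < n" "c < n" by auto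
    have cj: "q dvd c \<and> c div q = j \<longleftrightarrow> c = j * q" using assms(2) by auto
    have pi: "Suc p = i \<longleftrightarrow> i - 1 = p" using C_set_pos[OF i] by auto
    show ?case
    proof (cases "Suc p = i \<and> c = j * q")
      case True
      thus ?thesis using pc Yc piv pi new nin assms(2) by (auto simp: Y_def ij)
    next
      case False
      thus ?thesis using pc Yc piv[of c] pi cj by (auto simp: Y_def ij)
    qed
  qed (auto simp: Y_def)
  finally show ?case .
qed

lemma set_beta_indices: "set (beta_indices r q) = {(i, j). j \<in> {1..r} \<and> i \<in> C_set q j}"
  by (auto simp: beta_indices_def C_set_def)

lemma distinct_beta_indices: "distinct (beta_indices r q)"
proof -
  have "distinct (concat (map (\<lambda>j. map (\<lambda>i. (i, j)) (sorted_list_of_set (C_set q j))) js))"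
    if "distinct js" for js
    using that by (induction js) (auto simp: distinct_map inj_on_def)
  thus ?thesis by (simp add: beta_indices_def)
qed

lemma beta_transvection_bounds:
  assumes "n = r * q + 1" "q \<ge> 1" "j \<in> {1..r}" "i \<in> C_set q j"
  shows "i - 1 \<noteq> j * q" "i - 1 < n" "j * q < n"
proof -
  from C_set_pos[OF assms(4)] have S: "Suc (i - 1) \<in> C_set q j" using assms by simp
  show jn: "j * q < n" using assms mult_le_mono1[of j r q] by (auto simp: less_Suc_eq_le)
  from C_set_less[OF S] assms have "i - 1 < j * q" by auto
  thus "i - 1 \<noteq> j * q" "i - 1 < n" using jn by auto
qed

lemma mult_list_transvections:
  assumes "n = r * q + 1" "q \<ge> 1"
  shows "mult_list (PSL n) (map (\<lambda>(i, j). proj n (addrow_mat n (a i j) (i - 1) (j * q))) (beta_indices r q))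
         = proj n (cell_unipotent n r q a)"
    and "cell_unipotent n r q a \<in> carrier (SL n)"
proof -
  let ?As = "map (\<lambda>(i, j). addrow_mat n (a i j) (i - 1) (j * q)) (beta_indices r q)"
  have U: "foldr (*) ?As (1\<^sub>m n) = cell_unipotent n r q a"
    unfolding cell_unipotent_def
    by (subst foldr_transvections[OF assms]) (auto simp: set_beta_indices distinct_beta_indices)
  have SL: "set ?As \<subseteq> carrier (SL n)"
    using beta_transvection_bounds[OF assms] by (auto simp: set_beta_indices intro!: det_addrow_mat)
  have "map (\<lambda>(i, j). proj n (addrow_mat n (a i j) (i - 1) (j * q))) (beta_indices r q) = map (proj n) ?As"
    by auto
  thus "mult_list (PSL n) (map (\<lambda>(i, j). proj n (addrow_mat n (a i j) (i - 1) (j * q))) (beta_indices r q))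
         = proj n (cell_unipotent n r q a)"
    by (simp only: mult_list_proj[OF SL] U)
  show "cell_unipotent n r q a \<in> carrier (SL n)"
    using SL_foldr_closed[OF SL] unfolding U .
qed

lemma cell_unipotent_upper_triangular:
  assumes "q \<ge> 1"
  shows "upper_triangular (cell_unipotent n r q a)"
proof -
  have "\<not> Suc p \<in> C_set q (c div q)" if "c < p" "q dvd c" "c div q \<in> {1..r}" for p c
    using C_set_less[of p q "c div q"] that assms by auto
  thus ?thesis unfolding upper_triangular_def by (auto simp: cell_unipotent_def)
qed

text \<open>Two representatives of the same element of PSL differ by a scalar, and the upper left entry \<open>1\<close> shows
  that this scalar is \<open>1\<close>.\<close>

lemma cell_unipotent_inj:
  assumes "n = r * q + 1" "q \<ge> 1"
    and "proj n (cell_unipotent n r q a) = proj n (cell_unipotent n r q b)"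
    and "j \<in> {1..r}" "i \<in> C_set q j"
  shows "a i j = b i j"
proof -
  note SL = mult_list_transvections(2)[OF assms(1,2)]
  from assms(3) obtain \<zeta> where z: "cell_unipotent n r q a = \<zeta> \<cdot>\<^sub>m cell_unipotent n r q b"
    using proj_eq_iff[OF SL SL] by blast
  have e: "cell_unipotent n r q a $$ (p, c) = \<zeta> * cell_unipotent n r q b $$ (p, c)"
    if "p < n" "c < n" for p c
    using that unfolding z by (simp add: cell_unipotent_def)
  note B = beta_transvection_bounds[OF assms(1,2,4,5)]
  have "\<zeta> = 1" using e[of 0 0] assms(1) by (simp add: cell_unipotent_def)
  thus ?thesis using e[OF B(2,3)] B assms C_set_pos[OF assms(5)]
    by (simp add: cell_unipotent_def)
qed

lemma U_w_param:
  assumes "n = r * q + 1" "q \<ge> 1" "u \<in> U_w n r q"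
  obtains a where "u = proj n (cell_unipotent n r q a)"
proof -
  from assms(3) obtain g where u: "u = mult_list (PSL n) (map (\<lambda>(i, j). g i j) (beta_indices r q))"
    and g: "\<forall>j\<in>{1..r}. \<forall>i\<in>C_set q j. g i j \<in> root_subgroup n i (j * q)"
    unfolding U_w_def by blast
  have "\<forall>i j. \<exists>c. j \<in> {1..r} \<and> i \<in> C_set q j \<longrightarrow> g i j = proj n (addrow_mat n c (i - 1) (j * q))"
    using g unfolding root_subgroup_def by blast
  then obtain a where a: "\<And>i j. j \<in> {1..r} \<Longrightarrow> i \<in> C_set q j \<Longrightarrow>
      g i j = proj n (addrow_mat n (a i j) (i - 1) (j * q))" by metis
  have "u = mult_list (PSL n) (map (\<lambda>(i, j). proj n (addrow_mat n (a i j) (i - 1) (j * q))) (beta_indices r q))"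
    unfolding u by (intro arg_cong[where f = "mult_list _"] map_cong refl)
      (use a in \<open>auto simp: set_beta_indices\<close>)
  thus ?thesis using mult_list_transvections(1)[OF assms(1,2)] that by simp
qed

text \<open>Both \<open>x\<close> and the standard transvections parametrize the root subgroup bijectively, and both send \<open>0\<close>
  to the identity, \<open>x\<close> because it is a homomorphism.\<close>

lemma root_subgroup_iso_param:
  assumes "root_subgroup_iso n i l x" "i - 1 \<noteq> l" "i - 1 < n" "l < n"
  obtains \<phi> where "bij \<phi>" "\<phi> 0 = 0" "\<And>c. x c = proj n (addrow_mat n (\<phi> c) (i - 1) l)"
proof -
  let ?e = "\<lambda>c. proj n (addrow_mat n c (i - 1) l)"
  have inj: "?e a = ?e b \<longleftrightarrow> a = b" for a b by (rule proj_transvection_eq_iff) fact+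
  have x: "x \<in> iso \<lparr>carrier = UNIV, monoid.mult = (+), one = 0\<rparr> (PSL n\<lparr>carrier := root_subgroup n i l\<rparr>)"
    using assms(1) by (simp add: root_subgroup_iso_def)
  hence bij: "bij_betw x UNIV (range ?e)" and hom: "\<And>a b. x (a + b) = x a \<otimes>\<^bsub>PSL n\<^esub> x b"
    by (auto simp: iso_def hom_def root_subgroup_def)
  have "x c \<in> range ?e" for c using bij by (metis bij_betw_imp_surj_on rangeI)
  hence "\<forall>c. \<exists>b. x c = ?e b" by blast
  then obtain \<phi> where \<phi>: "\<And>c. x c = ?e (\<phi> c)" by metis
  have "bij \<phi>"
  proof (rule bijI)
    show "inj \<phi>" using bij by (auto simp: bij_betw_def inj_on_def \<phi>)
    show "surj \<phi>"
      unfolding surj_def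
    proof
      fix b
      have "?e b \<in> range x" using bij by (metis bij_betw_imp_surj_on rangeI)
      then obtain c where "?e b = x c" by blast
      hence "b = \<phi> c" by (simp add: \<phi> inj del: One_nat_def)
      thus "\<exists>c. b = \<phi> c" by blast
    qed
  qed
  moreover have "\<phi> 0 = 0"
  proof -
    interpret G: group "PSL n" by (rule group_PSL)
    have SL: "addrow_mat n c (i - 1) l \<in> carrier (SL n)" for c :: complex
      using assms by (auto simp: det_addrow_mat)
    have "?e (\<phi> 0) \<otimes>\<^bsub>PSL n\<^esub> ?e (\<phi> 0) = ?e (\<phi> 0)"
      using hom[of 0 0] by (simp add: \<phi>)
    hence "?e (\<phi> 0) = \<one>\<^bsub>PSL n\<^esub>"
      using G.l_cancel_one[OF proj_closed[OF SL] proj_closed[OF SL]] by blast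
    also have "\<dots> = ?e 0"
      unfolding proj_one[symmetric] by (intro arg_cong[where f = "proj n"] eq_matI) auto
    finally show ?thesis unfolding inj .
  qed
  ultimately show ?thesis using \<phi> that by blast
qed

text \<open>With the reparametrizations \<open>\<phi> i j\<close>, the coordinate \<open>X\<^sub>\<beta>\<close> of \<open>u\<close> is the preimage of \<open>a i j\<close> under
  \<open>\<phi> i j\<close>, and \<open>\<phi> i j\<close> fixes \<open>0\<close>.\<close>

lemma X_beta_eq_0_iff:
  assumes n: "n = r * q + 1" "q \<ge> 1"
    and x: "\<And>i j. j \<in> {1..r} \<Longrightarrow> i \<in> C_set q j \<Longrightarrow> root_subgroup_iso n i (j * q) (x i j)"
    and u: "u = proj n (cell_unipotent n r q a)"
    and ij: "j \<in> {1..r}" "i \<in> C_set q j"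
  shows "X_beta n r q x i j u = 0 \<longleftrightarrow> a i j = 0"
proof -
  have "\<forall>k l. \<exists>\<phi>. l \<in> {1..r} \<and> k \<in> C_set q l \<longrightarrow> bij \<phi> \<and> \<phi> 0 = 0 \<and>
      (\<forall>c. x k l c = proj n (addrow_mat n (\<phi> c) (k - 1) (l * q)))"
    using root_subgroup_iso_param[OF x beta_transvection_bounds[OF n]] by metis
  then obtain \<phi> where \<phi>: "\<And>k l. l \<in> {1..r} \<Longrightarrow> k \<in> C_set q l \<Longrightarrow> bij (\<phi> k l) \<and> \<phi> k l 0 = 0 \<and>
      (\<forall>c. x k l c = proj n (addrow_mat n (\<phi> k l c) (k - 1) (l * q)))" by metis
  have prod: "mult_list (PSL n) (map (\<lambda>(k, l). x k l (b k l)) (beta_indices r q)) =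
      proj n (cell_unipotent n r q (\<lambda>k l. \<phi> k l (b k l)))" for b
    unfolding mult_list_transvections(1)[OF n, symmetric]
    by (intro arg_cong[where f = "mult_list _"] map_cong refl)
      (use \<phi> in \<open>auto simp: set_beta_indices\<close>)
  have bij: "bij (\<phi> i j)" and zero: "\<phi> i j 0 = 0" using \<phi> ij by auto
  define c where "c = inv_into UNIV (\<phi> i j) (a i j)"
  have c: "\<phi> i j c = a i j" unfolding c_def using bij by (simp add: bij_is_surj surj_f_inv_f)
  have "X_beta n r q x i j u = c" unfolding X_beta_def prod
  proof (rule the_equality)
    have "cell_unipotent n r q (\<lambda>k l. \<phi> k l (inv_into UNIV (\<phi> k l) (a k l))) = cell_unipotent n r q a"
      using \<phi> unfolding cell_unipotent_def
      by (intro cong_mat refl) (auto simp: bij_is_surj surj_f_inv_f)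
    thus "\<exists>b. u = proj n (cell_unipotent n r q (\<lambda>k l. \<phi> k l (b k l))) \<and> b i j = c"
      unfolding u c_def by (intro exI[of _ "\<lambda>k l. inv_into UNIV (\<phi> k l) (a k l)"]) simp
  next
    fix c' assume "\<exists>b. u = proj n (cell_unipotent n r q (\<lambda>k l. \<phi> k l (b k l))) \<and> b i j = c'"
    then obtain b where b: "u = proj n (cell_unipotent n r q (\<lambda>k l. \<phi> k l (b k l)))" "b i j = c'"
      by blast
    have "\<phi> i j (b i j) = a i j"
      using cell_unipotent_inj[OF n _ ij, of "\<lambda>k l. \<phi> k l (b k l)" a] b u by simp
    thus "c' = c" using c b(2) bij by (metis bij_pointE)
  qed
  moreover have "c = 0 \<longleftrightarrow> a i j = 0" using c zero bij by (metis bij_pointE)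
  ultimately show ?thesis by simp
qed

section \<open>The Weyl group element\<close>

lemma simple_refl_mult_index:
  assumes "A \<in> carrier_mat n n" "i \<in> {1..<n}" "p < n" "c < n"
  shows "(simple_refl n i * A) $$ (p, c) =
    (if p = i - 1 then A $$ (i, c) else if p = i then - A $$ (i - 1, c) else A $$ (p, c))"
proof -
  define t where "t = (if p = i - 1 then i else if p = i then i - 1 else p)"
  have t: "t < n" using assms by (auto simp: t_def)
  have "(simple_refl n i * A) $$ (p, c) = (\<Sum>k<n. simple_refl n i $$ (p, k) * A $$ (k, c))"
    using assms by (simp add: scalar_prod_def simple_refl_def atLeast0LessThan)
  also have "\<dots> = (\<Sum>k<n. if k = t then (if p = i then -1 else 1) * A $$ (k, c) else 0)"
    using assms by (intro sum.cong refl) (auto simp: simple_refl_def t_def)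
  also have "\<dots> = (if p = i then -1 else 1) * A $$ (t, c)"
    using t by simp
  finally show ?thesis using assms by (auto simp: t_def)
qed

lemma simple_refl_SL:
  assumes "i \<in> {1..<n}"
  shows "simple_refl n i \<in> carrier (SL n)"
proof -
  let ?E = "addrow_mat n (1 :: complex) (i - 1) i" and ?F = "addrow_mat n (-1 :: complex) i (i - 1)"
  have eq: "simple_refl n i = ?E * (?F * ?E)"
  proof -
    have "simple_refl n i = addrow 1 (i - 1) i (addrow (-1) i (i - 1) ?E)"
      using assms by (intro eq_matI) (auto simp: simple_refl_def)
    also have "addrow (-1) i (i - 1) ?E = ?F * ?E"
      using assms by (intro addrow_mat) auto
    also have "addrow 1 (i - 1) i (?F * ?E) = ?E * (?F * ?E)"
      using assms by (intro addrow_mat[of _ _ n]) auto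
    finally show ?thesis .
  qed
  have "det ?E = 1" "det ?F = 1" using assms by (auto intro!: det_addrow_mat)
  hence "det (simple_refl n i) = 1"
    unfolding eq by (simp add: det_mult[of _ n] mult_carrier_mat[of _ n n])
  thus ?thesis by (simp add: simple_refl_def)
qed

abbreviation adjacent_swap :: "nat \<Rightarrow> nat \<Rightarrow> nat" where
  "adjacent_swap i \<equiv> Transposition.transpose (i - 1) i"

text \<open>The chosen representatives of the simple reflections are signed permutation matrices, hence so are
  their products. Only the underlying permutation matters: signs are absorbed in rescaling columns.\<close>

lemma foldr_simple_refl_column:
  assumes "set ws \<subseteq> {1..<n}" "k < n"
  shows "foldr adjacent_swap ws k < n \<and> (\<exists>\<epsilon>\<in>{1, -1}. \<forall>p<n.
    foldr (*) (map (simple_refl n) ws) (1\<^sub>m n) $$ (p, k) = (if p = foldr adjacent_swap ws k then \<epsilon> else 0))"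
  using assms(1)
proof (induction ws)
  case Nil
  thus ?case using assms(2) by (auto intro!: bexI[of _ 1])
next
  case (Cons i ws)
  let ?W = "foldr (*) (map (simple_refl n) ws) (1\<^sub>m n)" and ?s = "foldr adjacent_swap ws k"
  have W: "?W \<in> carrier_mat n n"
  proof -
    have "set (map (simple_refl n) ws) \<subseteq> carrier (SL n)"
      using Cons.prems simple_refl_SL by auto
    from SL_foldr_closed[OF this] show ?thesis by simp
  qed
  from Cons obtain \<epsilon> where s: "?s < n" and \<epsilon>: "\<epsilon> \<in> {1, -1}"
    "\<And>p. p < n \<Longrightarrow> ?W $$ (p, k) = (if p = ?s then \<epsilon> else 0)" by auto
  have i: "i \<in> {1..<n}" using Cons by auto
  have "(simple_refl n i * ?W) $$ (p, k) =
      (if p = adjacent_swap i ?s then (if ?s = i - 1 then - \<epsilon> else \<epsilon>) else 0)" if "p < n" for p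
    using that i s by (auto simp: simple_refl_mult_index[OF W i that assms(2)] \<epsilon>(2) Transposition.transpose_def)
  moreover have "adjacent_swap i ?s < n" using s i by (auto simp: Transposition.transpose_def)
  ultimately show ?case using \<epsilon>(1) by (intro conjI bexI[of _ "if ?s = i - 1 then - \<epsilon> else \<epsilon>"]) auto
qed

text \<open>The word \<open>s\<^sub>m \<cdots> s\<^sub>j\<close> applies \<open>s\<^sub>j\<close> first, so it carries the point \<open>j - 1\<close> all the way up.\<close>

lemma foldr_swap_ascending:
  "1 \<le> j \<Longrightarrow> j \<le> m \<Longrightarrow> foldr adjacent_swap (rev [j..<m]) (j - 1) = m - 1"
  unfolding foldr_conv_fold rev_rev_ident
proof (induction m)
  case (Suc m)
  show ?case
  proof (cases "j \<le> m")
    case True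
    thus ?thesis using Suc by (simp add: Transposition.transpose_def)
  next
    case False
    hence "j = Suc m" using Suc.prems by simp
    thus ?thesis by simp
  qed
qed simp

lemma foldr_swap_fixed:
  "x < j - 1 \<or> x \<ge> m \<Longrightarrow> foldr adjacent_swap (rev [j..<m]) x = x"
  unfolding foldr_conv_fold rev_rev_ident
  by (induction m) (auto simp: Transposition.transpose_def)

lemma le_mult_self: "q \<ge> 1 \<Longrightarrow> r \<le> r * q" for q r :: nat
  using mult_le_mono2[of 1 q r] by simp

lemma w_word_Suc: "q \<ge> 1 \<Longrightarrow> w_word (Suc r) q = w_word r q @ rev [Suc r..<Suc (Suc r * q)]"
  using le_mult_self[of q "Suc r"] by (simp add: w_word_def del: mult_Suc)

lemma foldr_w_word_fixed: "q \<ge> 1 \<Longrightarrow> x > r * q \<Longrightarrow> foldr adjacent_swap (w_word r q) x = x"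
proof (induction r)
  case (Suc r)
  have "foldr adjacent_swap (rev [Suc r..<Suc (Suc r * q)]) x = x"
    using Suc.prems by (intro foldr_swap_fixed) auto
  thus ?case using Suc by (simp only: w_word_Suc foldr_append) simp
qed (simp add: w_word_def)

text \<open>The point \<open>k\<close> is fixed by the factors \<open>s\<^sub>j\<^sub>q \<cdots> s\<^sub>j\<close> with \<open>j > k + 1\<close>, is sent to \<open>(k + 1) q\<close> by the
  one with \<open>j = k + 1\<close>, and is then out of reach of the remaining ones.\<close>

lemma foldr_w_word:
  assumes "q \<ge> 1" "k < r"
  shows "foldr adjacent_swap (w_word r q) k = Suc k * q"
  using assms(2)
proof (induction r)
  case (Suc r)
  show ?case
  proof (cases "k = r")
    case True
    have "Suc r \<le> Suc (Suc r * q)" using le_mult_self[OF assms(1), of "Suc r"] by linarith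
    from foldr_swap_ascending[OF _ this]
    have "foldr adjacent_swap (rev [Suc r..<Suc (Suc r * q)]) k = Suc r * q" using True by simp
    moreover have "Suc r * q > r * q" using assms(1) by simp
    ultimately show ?thesis
      unfolding w_word_Suc[OF assms(1)] foldr_append comp_def using foldr_w_word_fixed[OF assms(1)] True by metis
  next
    case False
    hence "foldr adjacent_swap (rev [Suc r..<Suc (Suc r * q)]) k = k"
      using Suc.prems by (intro foldr_swap_fixed) auto
    thus ?thesis using Suc False assms(1) by (simp only: w_word_Suc foldr_append comp_def)
  qed
qed simp

lemma w_rep_matrix:
  assumes "n = r * q + 1" "q \<ge> 1"
  obtains W \<epsilon> where "W \<in> carrier (SL n)" "w_rep n r q = proj n W" "\<And>k. k < r \<Longrightarrow> \<epsilon> k \<noteq> 0"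
    "\<And>p k. p < n \<Longrightarrow> k < r \<Longrightarrow> W $$ (p, k) = (if p = Suc k * q then \<epsilon> k else 0)"
proof -
  let ?As = "map (simple_refl n) (w_word r q)"
  let ?W = "foldr (*) ?As (1\<^sub>m n)"
  have ws: "set (w_word r q) \<subseteq> {1..<n}"
  proof
    fix i assume "i \<in> set (w_word r q)"
    then obtain j where j: "1 \<le> j" "j \<le> r" "j \<le> i" "i \<le> j * q"
      by (auto simp: w_word_def less_Suc_eq_le simp del: upt_Suc)
    moreover have "j * q \<le> r * q" using j by simp
    ultimately show "i \<in> {1..<n}" using assms unfolding atLeastLessThan_iff by linarith
  qed
  hence SL: "set ?As \<subseteq> carrier (SL n)" using simple_refl_SL by auto
  have rep: "w_rep n r q = proj n ?W"
    using mult_list_proj[OF SL] by (simp add: w_rep_def comp_def)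
  have "\<exists>e. e \<noteq> 0 \<and> (\<forall>p<n. ?W $$ (p, k) = (if p = Suc k * q then e else 0))" if "k < r" for k
  proof -
    have "k < n" using that le_mult_self[OF assms(2), of r] unfolding assms(1) by linarith
    from foldr_simple_refl_column[OF ws this] foldr_w_word[OF assms(2) that] show ?thesis
      by (metis insert_iff singletonD neg_equal_0_iff_equal one_neq_zero)
  qed
  then obtain \<epsilon> where "\<And>k. k < r \<Longrightarrow> \<epsilon> k \<noteq> 0 \<and> (\<forall>p<n. ?W $$ (p, k) = (if p = Suc k * q then \<epsilon> k else 0))"
    by metis
  thus ?thesis using that[of ?W \<epsilon>] SL_foldr_closed[OF SL] rep by blast
qed

lemma cell_column_entries:
  assumes "n = r * q + 1" "q \<ge> 1" "W \<in> carrier_mat n n"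
    and "\<And>p k. p < n \<Longrightarrow> k < r \<Longrightarrow> W $$ (p, k) = (if p = Suc k * q then \<epsilon> k else 0)"
    and "p < n" "k < r"
  shows "(cell_unipotent n r q a * W) $$ (p, k) = cell_entry q a p k * \<epsilon> k"
proof -
  have kr: "Suc k * q \<le> r * q" using assms by (intro mult_le_mono1) auto
  hence kn: "Suc k * q < n" using assms by linarith
  have "k < n" using assms(6) le_mult_self[OF assms(2), of r] unfolding assms(1) by linarith
  hence "(cell_unipotent n r q a * W) $$ (p, k) = (\<Sum>t<n. cell_unipotent n r q a $$ (p, t) * W $$ (t, k))"
    using assms by (simp add: scalar_prod_def cell_unipotent_def atLeast0LessThan)
  also have "\<dots> = (\<Sum>t<n. if t = Suc k * q then cell_unipotent n r q a $$ (p, t) * \<epsilon> k else 0)"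
    using assms by (intro sum.cong) auto
  also have "\<dots> = cell_unipotent n r q a $$ (p, Suc k * q) * \<epsilon> k"
    using kn by simp
  also have "cell_unipotent n r q a $$ (p, Suc k * q) = cell_entry q a p k"
  proof -
    have "Suc k * q div q = Suc k" "q dvd Suc k * q" using assms(2) by simp_all
    moreover have "p = Suc k * q \<Longrightarrow> Suc p \<notin> C_set q (Suc k)"
      using C_set_not_pivot[of p q "Suc k" "Suc k"] assms(2) by auto
    ultimately show ?thesis using assms kn
      by (simp add: cell_unipotent_def cell_entry_def del: mult_Suc)
  qed
  finally show ?thesis .
qed

section \<open>Independent transversals of the blocks\<close>

text \<open>Linear independence of the rows \<open>I\<close> when there are \<open>r\<close> of them. The vectors are sequences supported on
  \<open>{..<r}\<close>, which allows them to be truncated without changing types.\<close>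

definition trivial_kernel :: "nat \<Rightarrow> (nat \<Rightarrow> nat \<Rightarrow> complex) \<Rightarrow> nat set \<Rightarrow> bool" where
  "trivial_kernel r M I \<longleftrightarrow>
     (\<forall>c. (\<forall>k\<ge>r. c k = 0) \<longrightarrow> (\<forall>i\<in>I. (\<Sum>k<r. M i k * c k) = 0) \<longrightarrow> (\<forall>k. c k = 0))"

lemma cell_entry_pivot_row:
  assumes "q \<ge> 1"
  shows "cell_entry q a (Suc l * q) k = (if k = l then 1 else 0)"
proof -
  have "Suc (Suc l * q) \<notin> C_set q (Suc k)"
    using C_set_not_pivot[of "Suc l * q" q "Suc k" "Suc l"] assms by auto
  moreover have "Suc l * q = Suc k * q \<longleftrightarrow> k = l" using assms by auto
  ultimately show ?thesis by (auto simp: cell_entry_def simp del: mult_Suc)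
qed

text \<open>A row which is not a pivot and lies in block \<open>b\<close> is below the pivots of the columns \<open>k < b\<close>.\<close>

lemma cell_entry_eq_0:
  assumes "q \<ge> 1" "Suc i \<in> C_set q l" "k < i div q"
  shows "cell_entry q a i k = 0"
proof -
  have ki: "Suc k * q \<le> i"
    using assms by (metis Suc_leI div_times_less_eq_dividend mult_le_mono1 order_trans)
  have "i \<noteq> Suc k * q" using C_set_not_pivot[OF assms(2), of "Suc k"] assms(1) by auto
  moreover have "Suc i \<notin> C_set q (Suc k)"
    using C_set_less[of i q "Suc k"] ki assms(1) by auto
  ultimately show ?thesis by (simp add: cell_entry_def)
qed

text \<open>There are rows, one from each of the first \<open>l\<close> blocks, that are independent on the first \<open>l\<close> columns.
  Take a nonzero entry of column \<open>l - 1\<close> off the pivot, in a row \<open>i\<close> of some block \<open>b < l\<close>. Use the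
  rows found before for the blocks below \<open>b\<close>, the row \<open>i\<close> for \<open>b\<close>, and pivot rows for the blocks after
  \<open>b\<close>. The latter kill the columns \<open>b, \<dots>, l - 2\<close>; row \<open>i\<close> vanishes on the columns before \<open>b\<close>, so it
  kills column \<open>l - 1\<close>; the first \<open>b\<close> columns remain.\<close>

lemma partial_transversal:
  assumes "q \<ge> 1" "\<And>j. j \<in> {1..r} \<Longrightarrow> \<exists>i\<in>C_set q j. a i j \<noteq> 0" "l \<le> r"
  shows "\<exists>f. (\<forall>b<l. f b div q = b) \<and>
    (\<forall>c. (\<forall>k\<ge>l. c k = 0) \<longrightarrow> (\<forall>b<l. (\<Sum>k<r. cell_entry q a (f b) k * c k) = 0) \<longrightarrow> (\<forall>k. c k = 0))"
  using assms(3)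
proof (induction l rule: less_induct)
  case (less l)
  show ?case
  proof (cases l)
    case 0
    thus ?thesis by auto
  next
    case (Suc l')
    from assms(2)[of l] less.prems Suc obtain i' where i': "i' \<in> C_set q l" "a i' l \<noteq> 0" by auto
    define i where "i = i' - 1"
    have i: "Suc i \<in> C_set q l" "a (Suc i) l \<noteq> 0"
      using i' C_set_pos[OF i'(1)] by (simp_all add: i_def)
    have il: "i < l * q" using C_set_less[OF i(1)] Suc assms(1) by auto
    define b0 where "b0 = i div q"
    have b0: "b0 < l" unfolding b0_def using il by (simp add: less_mult_imp_div_less)
    from less.IH[OF b0] b0 less.prems obtain f where
      f: "\<And>b. b < b0 \<Longrightarrow> f b div q = b"
      "\<And>c. \<forall>k\<ge>b0. c k = 0 \<Longrightarrow>
         \<forall>b<b0. (\<Sum>k<r. cell_entry q a (f b) k * c k) = 0 \<Longrightarrow> \<forall>k. c k = 0"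
      by auto
    define g where "g = (\<lambda>b. if b < b0 then f b else if b = b0 then i else b * q)"
    have "\<forall>b<l. g b div q = b" using f(1) assms(1) by (auto simp: g_def b0_def)
    moreover have "c k = 0"
      if c: "\<forall>k\<ge>l. c k = 0" "\<forall>b<l. (\<Sum>k<r. cell_entry q a (g b) k * c k) = 0" for c k
    proof -
      \<comment> \<open>the pivot of column \<open>k\<close> represents block \<open>k + 1\<close>, which comes after \<open>b0\<close>\<close>
      have mid: "c k = 0" if "b0 \<le> k" "k < l'" for k
      proof -
        have "(\<Sum>t<r. cell_entry q a (Suc k * q) t * c t) = 0"
          using c(2)[rule_format, of "Suc k"] that Suc by (auto simp: g_def)
        moreover have "(\<Sum>t<r. cell_entry q a (Suc k * q) t * c t) = (\<Sum>t<r. if t = k then c k else 0)"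
          unfolding cell_entry_pivot_row[OF assms(1)] by (intro sum.cong) auto
        ultimately show ?thesis using that Suc less.prems by simp
      qed
      \<comment> \<open>in row \<open>i\<close> the columns before \<open>b0\<close> are zero, and those from \<open>b0\<close> to \<open>l' - 1\<close> have coefficient zero\<close>
      have "c l' = 0"
      proof -
        have row: "cell_entry q a i t * c t = (if t = l' then a (Suc i) l * c l' else 0)" for t
        proof -
          consider "t < b0" | "b0 \<le> t" "t < l'" | "t = l'" | "t \<ge> l" using Suc by linarith
          thus ?thesis
          proof cases
            case 1
            thus ?thesis using cell_entry_eq_0[OF assms(1) i(1), of t] b0 Suc by (auto simp: b0_def)
          next
            case 3
            have "i \<noteq> Suc l' * q" using il Suc by simp
            thus ?thesis using 3 i(1) Suc by (simp add: cell_entry_def)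
          qed (use mid c(1) Suc in auto)
        qed
        have "(\<Sum>t<r. cell_entry q a i t * c t) = 0"
          using c(2)[rule_format, of b0] b0 by (simp add: g_def)
        thus ?thesis unfolding row using i(2) Suc less.prems by simp
      qed
      hence tail: "c k = 0" if "k \<ge> b0" for k
        using mid[of k] c(1) that Suc by (cases "k < l'"; cases "k = l'") auto
      have "(\<Sum>k<r. cell_entry q a (f b) k * c k) = 0" if "b < b0" for b
        using c(2)[rule_format, of b] that b0 by (simp add: g_def)
      with f(2)[of c] tail show "c k = 0" by blast
    qed
    ultimately show ?thesis by blast
  qed
qed

text \<open>Below block \<open>m\<close> a partial transversal serves, and above it the pivot rows: the pivots in the blocks
  after \<open>m\<close> belong exactly to the columns \<open>k \<ge> m\<close>.\<close>

lemma transversal_omitting_block: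
  assumes "q \<ge> 1" "\<And>j. j \<in> {1..r} \<Longrightarrow> \<exists>i\<in>C_set q j. a i j \<noteq> 0" "m \<le> r"
  shows "\<exists>f. (\<forall>b\<in>{..r} - {m}. f b div q = b \<and> f b < r * q + 1) \<and>
    trivial_kernel r (cell_entry q a) (f ` ({..r} - {m}))"
proof -
  from partial_transversal[OF assms] obtain f where
    f: "\<And>b. b < m \<Longrightarrow> f b div q = b"
    "\<And>c. \<forall>k\<ge>m. c k = 0 \<Longrightarrow>
       \<forall>b<m. (\<Sum>k<r. cell_entry q a (f b) k * c k) = 0 \<Longrightarrow> \<forall>k. c k = 0"
    by auto
  define g where "g = (\<lambda>b. if b < m then f b else b * q)"
  have 1: "g b div q = b \<and> g b < r * q + 1" if "b \<in> {..r} - {m}" for b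
  proof (cases "b < m")
    case True
    hence "f b div q < r" using f(1) assms(3) by simp
    hence "f b < r * q" using assms(1) by (simp add: div_less_iff_less_mult)
    thus ?thesis using True f(1) by (simp add: g_def)
  next
    case False
    have "b * q \<le> r * q" using that by (intro mult_le_mono1) auto
    hence "b * q < r * q + 1" by linarith
    thus ?thesis using False assms(1) by (simp add: g_def)
  qed
  have 2: "trivial_kernel r (cell_entry q a) (g ` ({..r} - {m}))"
    unfolding trivial_kernel_def
  proof (intro allI impI)
    fix c k assume c: "\<forall>k\<ge>r. c k = 0"
      "\<forall>i\<in>g ` ({..r} - {m}). (\<Sum>k<r. cell_entry q a i k * c k) = 0"
    have tail: "c k = 0" if "k \<ge> m" for k
    proof (cases "k < r")
      case True
      have "(\<Sum>t<r. cell_entry q a (Suc k * q) t * c t) = 0"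
        using c(2)[rule_format, OF imageI, of "Suc k"] that True by (simp add: g_def)
      moreover have "(\<Sum>t<r. cell_entry q a (Suc k * q) t * c t) = (\<Sum>t<r. if t = k then c k else 0)"
        unfolding cell_entry_pivot_row[OF assms(1)] by (intro sum.cong) auto
      ultimately show ?thesis using True by simp
    qed (use c in auto)
    have "(\<Sum>k<r. cell_entry q a (f b) k * c k) = 0" if "b < m" for b
      using c(2)[rule_format, OF imageI, of b] that assms(3) by (simp add: g_def)
    with f(2)[of c] tail show "c k = 0" by blast
  qed
  from 1 2 show ?thesis by blast
qed

section \<open>Pluecker coordinates\<close>

lemma bij_betw_pick:
  assumes "finite I"
  shows "bij_betw (pick I) {..<card I} I"
proof -
  have "I \<subseteq> pick I ` {..<card I}"
  proof
    fix i assume i: "i \<in> I"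
    hence "{a \<in> I. a < i} \<subset> I" by auto
    hence "card {a \<in> I. a < i} < card I" using assms by (intro psubset_card_mono)
    hence "pick I (card {a \<in> I. a < i}) \<in> pick I ` {..<card I}" by blast
    thus "i \<in> pick I ` {..<card I}" unfolding pick_card_in_set[OF i] .
  qed
  moreover have "card (pick I ` {..<card I}) \<le> card I"
    using card_image_le[of "{..<card I}" "pick I"] by simp
  ultimately have eq: "pick I ` {..<card I} = I"
    by (metis card_seteq finite_imageI finite_lessThan)
  thus ?thesis unfolding bij_betw_def by (auto intro: eq_card_imp_inj_on)
qed

lemma pick_initial: "b < r \<Longrightarrow> pick {0..<r} b = b"
proof -
  assume "b < r"
  hence "pick {0..<r} (card {a \<in> {0..<r}. a < b}) = b" by (intro pick_card_in_set) auto
  moreover from \<open>b < r\<close> have "{a \<in> {0..<r}. a < b} = {..<b}" by auto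
  ultimately show ?thesis by simp
qed

lemma subsets_of_sizeD:
  assumes "I \<in> subsets_of_size n r"
  shows "finite I" "card I = r" "bij_betw (pick I) {..<r} I" "{i. i < n \<and> i \<in> I} = I"
proof -
  have I: "I \<subseteq> {0..<n}" "card I = r" using assms by (auto simp: subsets_of_size_def)
  show "finite I" using I finite_subset by blast
  thus "bij_betw (pick I) {..<r} I" using bij_betw_pick I(2) by blast
  show "card I = r" "{i. i < n \<and> i \<in> I} = I" using I by auto
qed

lemma pick_surj:
  assumes "I \<in> subsets_of_size n r" "i \<in> I"
  obtains x where "x < r" "pick I x = i"
proof -
  have "i \<in> pick I ` {..<r}"
    using subsets_of_sizeD(3)[OF assms(1)] assms(2) by (simp add: bij_betw_imp_surj_on)
  thus ?thesis using that by blast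
qed

lemma finite_subsets_of_size [simp]: "finite (subsets_of_size n r)"
  by (rule finite_subset[of _ "Pow {0..<n}"]) (auto simp: subsets_of_size_def)

lemma plucker_det:
  assumes "I \<in> subsets_of_size n r" "A \<in> carrier_mat n n" "r \<le> n"
  shows "plucker n r A I = det (mat r r (\<lambda>(x, k). A $$ (pick I x, k)))"
proof -
  have "{j. j < n \<and> j \<in> {0..<r}} = {0..<r}" using assms(3) by auto
  hence "submatrix A I {0..<r} = mat r r (\<lambda>(x, k). A $$ (pick I x, pick {0..<r} k))"
    using assms subsets_of_sizeD[OF assms(1)] by (simp add: submatrix_def)
  also have "\<dots> = mat r r (\<lambda>(x, k). A $$ (pick I x, k))"
    by (intro cong_mat) (auto simp: pick_initial)
  finally show ?thesis using assms by (simp add: plucker_def)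
qed

lemma det_nonzero_if_trivial_kernel:
  assumes "\<And>c. \<forall>k\<ge>r. c k = 0 \<Longrightarrow> \<forall>x<r. (\<Sum>k<r. g x k * c k) = 0 \<Longrightarrow> \<forall>k. c k = 0"
  shows "det (mat r r (\<lambda>(x, k). g x k :: complex)) \<noteq> 0"
proof
  let ?S = "mat r r (\<lambda>(x, k). g x k)"
  assume "det ?S = 0"
  then obtain v where v: "v \<in> carrier_vec r" "v \<noteq> 0\<^sub>v r" "?S *\<^sub>v v = 0\<^sub>v r"
    using det_0_iff_vec_prod_zero[of ?S r] by auto
  define c where "c = (\<lambda>k. if k < r then v $ k else 0)"
  have "(\<Sum>k<r. g x k * c k) = 0" if "x < r" for x
  proof -
    have "(?S *\<^sub>v v) $ x = (\<Sum>k<r. g x k * c k)"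
      using that v(1) by (simp add: scalar_prod_def c_def atLeast0LessThan)
    thus ?thesis using v(3) that by simp
  qed
  hence "\<forall>k. c k = 0" by (intro assms) (auto simp: c_def)
  hence "v = 0\<^sub>v r" using v(1) by (intro eq_vecI) (auto simp: c_def split: if_splits)
  thus False using v(2) by simp
qed

lemma plucker_nonzero:
  assumes "I \<in> subsets_of_size n r" "A \<in> carrier_mat n n" "r \<le> n"
    and "trivial_kernel r (\<lambda>i k. A $$ (i, k)) I"
  shows "plucker n r A I \<noteq> 0"
  unfolding plucker_det[OF assms(1-3)]
proof (rule det_nonzero_if_trivial_kernel)
  fix c assume c: "\<forall>k\<ge>r. c k = 0" "\<forall>x<r. (\<Sum>k<r. A $$ (pick I x, k) * c k) = 0"
  have "(\<Sum>k<r. A $$ (i, k) * c k) = 0" if "i \<in> I" for i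
    using c(2) pick_surj[OF assms(1) that] by metis
  thus "\<forall>k. c k = 0" using assms(4) c(1) unfolding trivial_kernel_def by blast
qed

text \<open>Torus elements act on the minors through row factors; column factors arise from the choice of a basis
  of the subspace.\<close>

lemma det_scale_rows_cols:
  "det (mat r r (\<lambda>(x, k). d x * g x k * e k)) =
   (\<Prod>x<r. d x) * det (mat r r (\<lambda>(x, k). g x k :: complex)) * (\<Prod>k<r. e k)"
proof -
  let ?G = "mat r r (\<lambda>(x, k). g x k)"
  have "mat r r (\<lambda>(x, k). d x * g x k * e k) = mat_diag r d * ?G * mat_diag r e"
    by (subst mat_diag_mult_left[of _ r r], simp, subst mat_diag_mult_right[of _ r r]) auto
  thus ?thesis by (simp add: det_mult[of _ r] mult_carrier_mat[of _ r r] det_mat_diag)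
qed

text \<open>Diagonal matrices have no minors off the diagonal: if \<open>I\<close> is not contained in \<open>J\<close>, some row of the
  submatrix is zero.\<close>

lemma ext_act_diag:
  assumes "r \<le> n"
  shows "ext_act n r (mat_diag n d) v I =
    (if I \<in> subsets_of_size n r then (\<Prod>i\<in>I. d i) * v I else 0)"
proof (cases "I \<in> subsets_of_size n r")
  case True
  note D = subsets_of_sizeD[OF True]
  have minor: "det (submatrix (mat_diag n d) I J) = (if J = I then \<Prod>i\<in>I. d i else 0)"
    if J: "J \<in> subsets_of_size n r" for J
  proof -
    note E = subsets_of_sizeD[OF J]
    have lt: "pick I x < n" "pick J x < n" if "x < r" for x
      using D(3,4) E(3,4) that by (auto dest!: bij_betwE)
    have S: "submatrix (mat_diag n d) I J =
        mat r r (\<lambda>(x, k). if pick I x = pick J k then d (pick J k) else 0)" (is "_ = ?S")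
      using D E lt by (auto simp: submatrix_def mat_diag_def intro!: eq_matI)
    show ?thesis
    proof (cases "J = I")
      case True
      have "inj_on (pick I) {..<r}" using D(3) by (simp add: bij_betw_def)
      hence "?S = mat_diag r (\<lambda>x. d (pick I x))"
        using True by (intro eq_matI) (auto simp: mat_diag_def inj_on_def)
      hence "det ?S = (\<Prod>x<r. d (pick I x))" by (simp add: det_mat_diag)
      also have "\<dots> = (\<Prod>i\<in>I. d i)" by (rule prod.reindex_bij_betw[OF D(3)])
      finally show ?thesis using S True by simp
    next
      case False
      have "\<not> I \<subseteq> J" using False card_subset_eq[of J I] D(2) E(1,2) by auto
      then obtain i where i: "i \<in> I" "i \<notin> J" by auto
      then obtain x where x: "x < r" "pick I x = i" using pick_surj[OF True] by metis
      have "?S $$ (x, k) = 0" if "k < r" for k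
        using x i that E(3) by (auto dest: bij_betwE)
      \<comment> \<open>a zero row can be scaled by \<open>0\<close>\<close>
      hence "?S = mat r r (\<lambda>(y, k). (if y = x then 0 else 1) *
          (if pick I y = pick J k then d (pick J k) else 0) * 1)"
        using x by (intro eq_matI) auto
      also have "det \<dots> = 0"
        using x(1) by (subst det_scale_rows_cols) auto
      finally show ?thesis using S False by simp
    qed
  qed
  have "(\<Sum>J\<in>subsets_of_size n r. det (submatrix (mat_diag n d) I J) * v J) =
      (\<Sum>J\<in>subsets_of_size n r. if J = I then (\<Prod>i\<in>I. d i) * v I else 0)"
    by (intro sum.cong refl) (simp add: minor)
  thus ?thesis using True by (simp add: ext_act_def)
qed (simp add: ext_act_def)

lemma tendsto_det:
  assumes "\<And>x k. x < r \<Longrightarrow> k < r \<Longrightarrow> ((\<lambda>t. G t x k) \<longlongrightarrow> (G0 x k :: complex)) F"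
  shows "((\<lambda>t. det (mat r r (\<lambda>(x, k). G t x k))) \<longlongrightarrow> det (mat r r (\<lambda>(x, k). G0 x k))) F"
proof -
  have "((\<lambda>t. \<Sum>p | p permutes {0..<r}. signof p * (\<Prod>i = 0..<r. G t i (p i)))
      \<longlongrightarrow> (\<Sum>p | p permutes {0..<r}. signof p * (\<Prod>i = 0..<r. G0 i (p i)))) F"
    by (intro tendsto_sum tendsto_mult tendsto_const tendsto_prod assms)
      (auto dest: permutes_in_image)
  moreover have "det (mat r r (\<lambda>(x, k). H x k)) =
      (\<Sum>p | p permutes {0..<r}. signof p * (\<Prod>i = 0..<r. H i (p i)))" for H :: "nat \<Rightarrow> nat \<Rightarrow> complex"
    by (subst det_def'[of _ r]) (auto intro!: sum.cong prod.cong dest: permutes_in_image)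
  ultimately show ?thesis by simp
qed

lemma homog_polys_tendsto:
  assumes "f \<in> homog_polys n r d" "\<And>I. I \<in> subsets_of_size n r \<Longrightarrow> ((\<lambda>t. v t I) \<longlongrightarrow> v0 I) F"
  shows "((\<lambda>t. f (v t)) \<longlongrightarrow> f v0) F"
proof -
  from assms(1) obtain E c where "finite E"
    "f = (\<lambda>v. \<Sum>e\<in>E. c e * (\<Prod>I\<in>subsets_of_size n r. v I ^ e I))"
    by (auto simp: homog_polys_def)
  thus ?thesis by (simp add: tendsto_sum tendsto_mult tendsto_prod tendsto_power assms(2))
qed

lemma homog_polys_scale:
  assumes "f \<in> homog_polys n r d"
  shows "f (\<lambda>I. c * v I) = c ^ d * f v"
proof -
  from assms obtain E b where f: "f = (\<lambda>v. \<Sum>e\<in>E. b e * (\<Prod>I\<in>subsets_of_size n r. v I ^ e I))"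
    and E: "\<forall>e\<in>E. (\<Sum>I\<in>subsets_of_size n r. e I) = d"
    by (auto simp: homog_polys_def)
  have "(\<Prod>I\<in>subsets_of_size n r. (c * v I) ^ e I) =
      c ^ d * (\<Prod>I\<in>subsets_of_size n r. v I ^ e I)" if "e \<in> E" for e
    using E that by (simp add: power_mult_distrib prod.distrib flip: power_sum)
  hence "f (\<lambda>I. c * v I) = (\<Sum>e\<in>E. b e * (c ^ d * (\<Prod>I\<in>subsets_of_size n r. v I ^ e I)))"
    unfolding f by (intro sum.cong) auto
  thus ?thesis unfolding f by (simp add: sum_distrib_left mult.left_commute)
qed

lemma monomial_homog:
  assumes "\<And>k. k < d \<Longrightarrow> T k \<in> subsets_of_size n r"
  shows "(\<lambda>v. \<Prod>k<d. v (T k)) \<in> homog_polys n r d"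
proof -
  define e where "e = (\<lambda>I. card {k \<in> {..<d}. T k = I})"
  have im: "T ` {..<d} \<subseteq> subsets_of_size n r" using assms by auto
  have "(\<Prod>k<d. v (T k)) = (\<Prod>I\<in>subsets_of_size n r. v I ^ e I)" for v :: "nat set \<Rightarrow> complex"
    using prod.group[OF _ _ im, of "\<lambda>k. v (T k)"] by (simp add: e_def)
  moreover have "(\<Sum>I\<in>subsets_of_size n r. e I) = d"
    using sum.group[OF _ _ im, of "\<lambda>_. 1 :: nat"] by (simp add: e_def)
  ultimately show ?thesis unfolding homog_polys_def
    by (intro CollectI exI[of _ "{e}"] exI[of _ "\<lambda>_. 1"]) auto
qed

section \<open>Semistability on the open cell\<close>

text \<open>The choice of a representative \<open>W\<close> of \<open>w\<close> enters the Pluecker coordinates through the factors \<open>\<epsilon> k\<close>, one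
  for each of the first \<open>r\<close> columns.\<close>

locale grassmann_cell =
  fixes n r q :: nat and W :: "complex mat" and \<epsilon> :: "nat \<Rightarrow> complex"
  assumes n_eq: "n = r * q + 1" and q_pos: "q \<ge> 1"
    and W_SL: "W \<in> carrier (SL n)" and w_rep_eq: "w_rep n r q = proj n W"
    and \<epsilon>_nz: "\<And>k. k < r \<Longrightarrow> \<epsilon> k \<noteq> 0"
    and W_index: "\<And>p k. p < n \<Longrightarrow> k < r \<Longrightarrow> W $$ (p, k) = (if p = Suc k * q then \<epsilon> k else 0)"
begin

abbreviation X :: "complex mat set set set" where
  "X \<equiv> schubert_variety n r (w_rep n r q)"

definition cell_matrix :: "(nat \<Rightarrow> nat \<Rightarrow> complex) \<Rightarrow> complex mat" where
  "cell_matrix a = cell_unipotent n r q a * W"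

definition cell_point :: "(nat \<Rightarrow> nat \<Rightarrow> complex) \<Rightarrow> complex mat set set" where
  "cell_point a = (proj n (cell_unipotent n r q a) \<otimes>\<^bsub>PSL n\<^esub> w_rep n r q) <#\<^bsub>PSL n\<^esub> max_parabolic n r"

lemma r_le_n: "r \<le> n"
  using le_mult_self[OF q_pos, of r] unfolding n_eq by linarith

lemma cell_unipotent_SL: "cell_unipotent n r q a \<in> carrier (SL n)"
  by (rule mult_list_transvections(2)[OF n_eq q_pos])

lemma cell_matrix_SL: "cell_matrix a \<in> carrier (SL n)"
  unfolding cell_matrix_def by (rule SL_mult[OF cell_unipotent_SL W_SL])

lemma cell_matrix_carrier: "cell_matrix a \<in> carrier_mat n n"
  using cell_matrix_SL[of a] by simp

lemma cell_point_eq: "cell_point a = proj n (cell_matrix a) <#\<^bsub>PSL n\<^esub> max_parabolic n r"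
  unfolding cell_point_def cell_matrix_def w_rep_eq proj_mult[OF cell_unipotent_SL W_SL] ..

lemma cell_matrix_index:
  "p < n \<Longrightarrow> k < r \<Longrightarrow> cell_matrix a $$ (p, k) = cell_entry q a p k * \<epsilon> k"
  unfolding cell_matrix_def
  using cell_column_entries[OF n_eq q_pos _ W_index] W_SL by simp

lemma cell_matrix_mem: "cell_matrix a \<in> \<Union>(cell_point a)"
proof -
  have one: "1\<^sub>m n \<in> carrier (SL n)" by simp
  have "proj n (1\<^sub>m n) \<in> max_parabolic n r"
    unfolding max_parabolic_def using r_le_n by (intro imageI) auto
  hence "proj n (cell_matrix a * 1\<^sub>m n) \<in> cell_point a"
    unfolding cell_point_eq l_coset_def proj_mult[OF cell_matrix_SL one, symmetric] by blast
  moreover have "cell_matrix a * 1\<^sub>m n = cell_matrix a"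
    using cell_matrix_carrier by (rule right_mult_one_mat)
  ultimately show ?thesis using proj_self[OF cell_matrix_SL[of a]] by auto
qed

lemma cell_point_repr:
  assumes "A \<in> \<Union>(cell_point a)"
  obtains \<zeta> p where "\<zeta> \<noteq> 0" "p \<in> carrier (SL n)" "A = \<zeta> \<cdot>\<^sub>m (cell_matrix a * p)"
    "\<And>i j. i < n \<Longrightarrow> r \<le> i \<Longrightarrow> j < r \<Longrightarrow> p $$ (i, j) = 0"
proof -
  from assms obtain p where p: "p \<in> carrier (SL n)"
    "\<forall>i<n. \<forall>j<n. r \<le> i \<longrightarrow> j < r \<longrightarrow> p $$ (i, j) = 0"
    "A \<in> proj n (cell_matrix a) \<otimes>\<^bsub>PSL n\<^esub> proj n p"
    unfolding cell_point_eq l_coset_def max_parabolic_def by blast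
  have "cell_matrix a * p \<in> carrier (SL n)"
    by (rule SL_mult[OF cell_matrix_SL p(1)])
  moreover from p(3) have "A \<in> proj n (cell_matrix a * p)"
    unfolding proj_mult[OF cell_matrix_SL p(1)] .
  ultimately obtain \<zeta> where z: "\<zeta> ^ n = 1" "A = \<zeta> \<cdot>\<^sub>m (cell_matrix a * p)"
    using mem_proj_iff by blast
  moreover from z have "\<zeta> \<noteq> 0" using n_eq by (auto simp: power_0_left)
  ultimately show ?thesis using p(1,2) r_le_n by (intro that[of \<zeta> p]) auto
qed

lemma cell_point_in_schubert: "cell_point a \<in> X"
proof -
  let ?Y = "(\<lambda>b. (b \<otimes>\<^bsub>PSL n\<^esub> w_rep n r q) <#\<^bsub>PSL n\<^esub> max_parabolic n r) ` borel_subgroup n"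
  have "proj n (cell_unipotent n r q a) \<in> borel_subgroup n"
    unfolding borel_subgroup_def
    using cell_unipotent_SL cell_unipotent_upper_triangular[OF q_pos] by blast
  hence Y: "cell_point a \<in> ?Y" unfolding cell_point_def by blast
  moreover have "cell_point a \<in> grass n r"
    unfolding grass_def LCOSETS_def cell_point_eq using proj_closed[OF cell_matrix_SL] by blast
  moreover have "cone n r {cell_point a} \<subseteq> cone n r ?Y"
    using Y unfolding cone_def by blast
  ultimately show ?thesis unfolding schubert_variety_def zariski_closure_def by blast
qed

definition cell_vector :: "(nat \<Rightarrow> nat \<Rightarrow> complex) \<Rightarrow> nat set \<Rightarrow> complex" where
  "cell_vector a = plucker n r (cell_matrix a)"

lemma scaled_cell_vector_cone: "c \<noteq> 0 \<Longrightarrow> (\<lambda>I. c * cell_vector a I) \<in> cone n r {cell_point a}"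
  unfolding cone_def cell_vector_def
  by (intro CollectI exI[of _ c] exI[of _ "cell_matrix a"]) (use cell_matrix_mem[of a] in auto)

lemma cell_vector_cone: "cell_vector a \<in> cone n r {cell_point a}"
  using scaled_cell_vector_cone[of 1 a] by simp

lemma cone_cell_point_subset: "cone n r {cell_point a} \<subseteq> cone n r X"
  unfolding cone_def using cell_point_in_schubert by blast

lemma cell_vector_det:
  assumes "I \<in> subsets_of_size n r"
  shows "cell_vector a I = det (mat r r (\<lambda>(x, k). cell_entry q a (pick I x) k * \<epsilon> k))"
  unfolding cell_vector_def plucker_det[OF assms cell_matrix_carrier r_le_n]
proof (intro arg_cong[where f = det] cong_mat refl)
  fix x k assume "x < r" "k < r"
  moreover from this have "pick I x < n"
    using subsets_of_sizeD(3,4)[OF assms] by (auto dest!: bij_betwE)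
  ultimately show "(case (x, k) of (x, k) \<Rightarrow> cell_matrix a $$ (pick I x, k)) =
      (case (x, k) of (x, k) \<Rightarrow> cell_entry q a (pick I x) k * \<epsilon> k)"
    by (simp add: cell_matrix_index)
qed

text \<open>Other representatives of the coset \<open>u w P\<close> arise by right multiplication with some \<open>p\<close> in \<open>P\<close>, and the
  upper left block of \<open>p\<close> is invertible; so whether a Pluecker coordinate vanishes is decided by the
  echelon basis.\<close>

lemma plucker_cell_point_nonzero:
  assumes "trivial_kernel r (cell_entry q a) I" "I \<in> subsets_of_size n r" "A \<in> \<Union>(cell_point a)"
  shows "plucker n r A I \<noteq> 0"
proof -
  from assms(3) obtain \<zeta> p where z: "\<zeta> \<noteq> 0" and p: "p \<in> carrier (SL n)"
    and A: "A = \<zeta> \<cdot>\<^sub>m (cell_matrix a * p)"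
    and low: "\<And>i j. i < n \<Longrightarrow> r \<le> i \<Longrightarrow> j < r \<Longrightarrow> p $$ (i, j) = 0"
    by (rule cell_point_repr) (rule that)
  have pc: "p \<in> carrier_mat n n" using p by simp
  have Ac: "A \<in> carrier_mat n n" unfolding A using mult_carrier_mat[OF cell_matrix_carrier pc] by simp
  show ?thesis
  proof (rule plucker_nonzero[OF assms(2) Ac r_le_n], unfold trivial_kernel_def, intro allI impI)
    fix c k assume c: "\<forall>k\<ge>r. c k = 0" "\<forall>i\<in>I. (\<Sum>k<r. A $$ (i, k) * c k) = 0"
    define e where "e = (\<lambda>l. \<Sum>k<r. p $$ (l, k) * c k)"
    have A_idx: "A $$ (i, k) = \<zeta> * (\<Sum>l<r. cell_entry q a i l * \<epsilon> l * p $$ (l, k))"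
      if "i < n" "k < r" for i k
    proof -
      have "k < n" using that(2) r_le_n by simp
      hence "A $$ (i, k) = \<zeta> * (\<Sum>l<n. cell_matrix a $$ (i, l) * p $$ (l, k))"
        unfolding A using that cell_matrix_carrier[of a] pc
        by (simp add: scalar_prod_def atLeast0LessThan)
      also have "(\<Sum>l<n. cell_matrix a $$ (i, l) * p $$ (l, k)) =
          (\<Sum>l<r. cell_matrix a $$ (i, l) * p $$ (l, k))"
        using low that r_le_n by (intro sum.mono_neutral_right) auto
      also have "\<dots> = (\<Sum>l<r. cell_entry q a i l * \<epsilon> l * p $$ (l, k))"
        using that by (intro sum.cong) (auto simp: cell_matrix_index)
      finally show ?thesis .
    qed
    have "(\<Sum>l<r. cell_entry q a i l * (if l < r then \<epsilon> l * e l else 0)) = 0" if "i \<in> I" for i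
    proof -
      have i: "i < n" using that subsets_of_sizeD(4)[OF assms(2)] by auto
      have "0 = (\<Sum>k<r. A $$ (i, k) * c k)" using c(2) that by simp
      also have "\<dots> = (\<Sum>k<r. \<Sum>l<r. \<zeta> * (cell_entry q a i l * \<epsilon> l * p $$ (l, k) * c k))"
        using i by (intro sum.cong) (auto simp: A_idx sum_distrib_left sum_distrib_right mult_ac)
      also have "\<dots> = (\<Sum>l<r. \<Sum>k<r. \<zeta> * (cell_entry q a i l * \<epsilon> l * p $$ (l, k) * c k))"
        by (rule sum.swap)
      also have "\<dots> = \<zeta> * (\<Sum>l<r. cell_entry q a i l * (if l < r then \<epsilon> l * e l else 0))"
        by (simp add: e_def sum_distrib_left mult_ac)
      finally show ?thesis using z by simp
    qed
    hence "\<forall>l. (if l < r then \<epsilon> l * e l else 0) = 0"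
      using assms(1)[unfolded trivial_kernel_def, rule_format, of "\<lambda>l. if l < r then \<epsilon> l * e l else 0"]
      by auto
    hence e0: "e l = 0" if "l < r" for l using that \<epsilon>_nz[OF that] by (metis mult_eq_0_iff)
    \<comment> \<open>as the lower left block of \<open>p\<close> is zero, \<open>c\<close> is in the kernel of the whole of \<open>p\<close>\<close>
    have "p *\<^sub>v vec n c = 0\<^sub>v n"
    proof (rule eq_vecI)
      fix l assume "l < dim_vec (0\<^sub>v n :: complex vec)"
      hence l: "l < n" by simp
      have "(p *\<^sub>v vec n c) $ l = (\<Sum>k<n. p $$ (l, k) * c k)"
        using l pc by (simp add: scalar_prod_def atLeast0LessThan)
      also have "\<dots> = e l" unfolding e_def
        using c(1) r_le_n by (intro sum.mono_neutral_right) auto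
      also have "\<dots> = 0"
        using e0 low[OF l] by (cases "l < r") (auto simp: e_def)
      finally show "(p *\<^sub>v vec n c) $ l = 0\<^sub>v n $ l" using l by simp
    qed (use pc in auto)
    moreover have "det p \<noteq> 0" using p by simp
    ultimately have "vec n c = 0\<^sub>v n"
      using det_0_iff_vec_prod_zero[OF pc] vec_carrier[of n c] by blast
    hence "c k = 0" if "k < n" for k using that by (metis index_vec index_zero_vec(1))
    thus "c k = 0" using c(1) r_le_n by (cases "k < n") auto
  qed
qed

text \<open>With \<open>D\<close> the product of all \<open>d b\<close>, the index set omitting block \<open>m\<close> contributes \<open>D / d m\<close>. The value
  \<open>m = r\<close> is taken \<open>n - r\<close> times, so the product is the \<open>r\<close>-th power of the determinant.\<close>

lemma block_scalar_monomial_invariant: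
  fixes d :: "nat \<Rightarrow> complex"
  assumes d: "(\<Prod>b<r. d b) ^ q * d r = 1"
    and T: "\<And>m. m \<le> r \<Longrightarrow> \<forall>b\<in>{..r} - {m}. f m b div q = b"
  shows "(\<Prod>k<n. \<Prod>i\<in>f (min k r) ` ({..r} - {min k r}). d (i div q)) = 1"
proof -
  have "(\<Prod>b<r. d b) ^ q * d r \<noteq> 0" using d by simp
  hence nz: "d b \<noteq> 0" if "b \<le> r" for b
    using that q_pos by (cases "b = r") (auto simp: prod_zero_iff)
  define D where "D = (\<Prod>b\<le>r. d b)"
  have one: "(\<Prod>i\<in>f m ` ({..r} - {m}). d (i div q)) = D / d m" if m: "m \<le> r" for m
  proof -
    have "inj_on (f m) ({..r} - {m})"
      using T[OF m] by (intro inj_on_inverseI[of _ "\<lambda>i. i div q"]) auto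
    hence "(\<Prod>i\<in>f m ` ({..r} - {m}). d (i div q)) = (\<Prod>b\<in>{..r} - {m}. d (f m b div q))"
      by (simp add: prod.reindex)
    also have "\<dots> = (\<Prod>b\<in>{..r} - {m}. d b)" using T[OF m] by (intro prod.cong) auto
    also have "\<dots> = D / d m" using m nz[OF m] by (simp add: D_def prod_diff1)
    finally show ?thesis .
  qed
  have r_split: "{..<n} = {..<r} \<union> {r..<n}" using r_le_n by auto
  have "(\<Prod>k<n. D / d (min k r)) = (\<Prod>k<r. D / d (min k r)) * (\<Prod>k\<in>{r..<n}. D / d (min k r))"
    unfolding r_split by (rule prod.union_disjoint) auto
  also have "(\<Prod>k<r. D / d (min k r)) = D ^ r / (\<Prod>k<r. d k)"
    by (simp add: prod_dividef)
  also have "(\<Prod>k\<in>{r..<n}. D / d (min k r)) = (D / d r) ^ (n - r)"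
    by simp
  also have "D / d r = (\<Prod>b<r. d b)"
  proof -
    have "D = (\<Prod>b<r. d b) * d r" unfolding D_def lessThan_Suc_atMost[symmetric] by simp
    thus ?thesis using nz[of r] by simp
  qed
  also have "D ^ r / (\<Prod>k<r. d k) * (\<Prod>b<r. d b) ^ (n - r) = 1"
  proof -
    let ?P = "\<Prod>b<r. d b"
    have P: "?P \<noteq> 0" using nz by (simp add: prod_zero_iff)
    have D: "D = ?P * d r" unfolding D_def lessThan_Suc_atMost[symmetric] by simp
    have "D ^ r * ?P ^ (n - r) = ?P ^ (r + (n - r)) * d r ^ r"
      unfolding D power_add power_mult_distrib by (simp add: mult_ac)
    also have "r + (n - r) = r * q + 1" using r_le_n n_eq by simp
    also have "?P ^ (r * q + 1) * d r ^ r = (?P ^ q * d r) ^ r * ?P"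
      by (simp add: power_mult_distrib power_mult mult.commute[of r q])
    finally show ?thesis using d P by simp
  qed
  finally show ?thesis using one by simp
qed

proposition cell_point_semistable:
  assumes "\<And>j. j \<in> {1..r} \<Longrightarrow> \<exists>i\<in>C_set q j. a i j \<noteq> 0"
  shows "cell_point a \<in> semistable n r (T_J n r q) X"
proof -
  have "\<forall>m. \<exists>f. m \<le> r \<longrightarrow> (\<forall>b\<in>{..r} - {m}. f b div q = b \<and> f b < n) \<and>
      trivial_kernel r (cell_entry q a) (f ` ({..r} - {m}))"
    unfolding n_eq using transversal_omitting_block[where a = a, OF q_pos assms] by blast
  then obtain f where f: "\<And>m. m \<le> r \<Longrightarrow> \<forall>b\<in>{..r} - {m}. f m b div q = b"
      "\<And>m b. m \<le> r \<Longrightarrow> b \<in> {..r} - {m} \<Longrightarrow> f m b < n"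
      "\<And>m. m \<le> r \<Longrightarrow> trivial_kernel r (cell_entry q a) (f m ` ({..r} - {m}))" by metis
  \<comment> \<open>index sets of the factors: the one omitting block \<open>r\<close> is repeated for \<open>k = r, \<dots>, n - 1\<close>\<close>
  define T where "T = (\<lambda>k. f (min k r) ` ({..r} - {min k r}))"
  have T_sub: "T k \<in> subsets_of_size n r" for k
  proof -
    have "inj_on (f (min k r)) ({..r} - {min k r})"
      using f(1)[of "min k r"] by (intro inj_on_inverseI[of _ "\<lambda>i. i div q"]) auto
    hence "card (T k) = r" unfolding T_def by (simp add: card_image)
    moreover have "f (min k r) b \<in> {0..<n}" if "b \<in> {..r} - {min k r}" for b
      using f(2)[OF _ that] by simp
    hence "T k \<subseteq> {0..<n}" unfolding T_def by (rule image_subsetI)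
    ultimately show ?thesis by (simp add: subsets_of_size_def)
  qed
  have T_ker: "trivial_kernel r (cell_entry q a) (T k)" for k
    unfolding T_def by (rule f(3)) simp
  define s :: "(nat set \<Rightarrow> complex) \<Rightarrow> complex" where "s = (\<lambda>v. \<Prod>k<n. v (T k))"
  have "s \<in> sections_O n r X (n * 1)"
    unfolding sections_O_def
  proof (intro CollectI ballI)
    fix v
    have "s \<in> homog_polys n r (0 + n * 1)" unfolding s_def using monomial_homog[of n T] T_sub by simp
    moreover have "(\<lambda>v. 1) \<in> homog_polys n r 0"
      using monomial_homog[of 0 T n r] by simp
    ultimately show "\<exists>d. \<exists>f\<in>homog_polys n r (d + n * 1). \<exists>h\<in>homog_polys n r d.
        h v \<noteq> 0 \<and> (\<forall>v'\<in>cone n r X. h v' \<noteq> 0 \<longrightarrow> s v' = f v' / h v')"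
      \<comment> \<open>a polynomial is a quotient with denominator \<open>1\<close>\<close>
      by (intro exI[of _ 0] bexI[of _ s] bexI[of _ "\<lambda>v. 1"]) auto
  qed
  moreover have "invariant_section n r (T_J n r q) X s"
    unfolding invariant_section_def
  proof (intro ballI impI)
    fix A v assume A: "A \<in> carrier (SL n)" "proj n A \<in> T_J n r q"
    from T_J_block_scalar[OF A(2) n_eq q_pos] obtain d where
      d: "(\<Prod>b<r. d b) ^ q * d r = 1" "proj n A = proj n (mat_diag n (\<lambda>i. d (i div q)))" by blast
    then obtain \<zeta> where z: "\<zeta> ^ n = 1" "A = \<zeta> \<cdot>\<^sub>m mat_diag n (\<lambda>i. d (i div q))"
      using proj_eq_iff[OF A(1) block_diag_SL[OF d(1) n_eq q_pos]] by blast
    have Ad: "A = mat_diag n (\<lambda>i. \<zeta> * d (i div q))"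
      unfolding z by (intro eq_matI) (auto simp: mat_diag_def)
    have "s (ext_act n r A v) = (\<Prod>k<n. (\<Prod>i\<in>T k. \<zeta> * d (i div q)) * v (T k))"
      unfolding s_def Ad ext_act_diag[OF r_le_n] using T_sub by simp
    also have "\<dots> = (\<Prod>k<n. \<zeta> ^ r * (\<Prod>i\<in>T k. d (i div q)) * v (T k))"
      using subsets_of_sizeD(2)[OF T_sub] by (intro prod.cong) (auto simp: prod.distrib)
    also have "\<dots> = (\<zeta> ^ n) ^ r * (\<Prod>k<n. \<Prod>i\<in>T k. d (i div q)) * s v"
      by (simp add: prod.distrib s_def flip: power_mult) (simp add: mult.commute)
    also have "(\<Prod>k<n. \<Prod>i\<in>T k. d (i div q)) = 1"
      unfolding T_def by (rule block_scalar_monomial_invariant[OF d(1) f(1)])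
    finally show "s (ext_act n r A v) = s v" using z by simp
  qed
  moreover have "s v \<noteq> 0" if "v \<in> cone n r {cell_point a}" for v
  proof -
    from that obtain c A where v: "v = (\<lambda>I. c * plucker n r A I)" "c \<noteq> 0" "A \<in> \<Union>(cell_point a)"
      unfolding cone_def by blast
    have "v (T k) \<noteq> 0" for k
      using plucker_cell_point_nonzero[OF T_ker T_sub v(3)] v(1,2) by simp
    thus ?thesis by (simp add: s_def prod_zero_iff)
  qed
  ultimately show ?thesis
    unfolding semistable_def using cell_point_in_schubert[of a] by (intro CollectI conjI exI[of _ 1]) auto
qed

text \<open>From here up to the vanishing of invariant sections, column \<open>j - 1\<close> has no nonzero entry besides its
  pivot.\<close>

context
  fixes a :: "nat \<Rightarrow> nat \<Rightarrow> complex" and j :: nat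
  assumes j: "j \<in> {1..r}" and column_zero: "\<And>i. i \<in> C_set q j \<Longrightarrow> a i j = 0"
begin

text \<open>The degeneration of the point: the coordinates in block \<open>j\<close> outside column \<open>j - 1\<close> are scaled by \<open>t\<close>.
  For every \<open>t\<close>, including \<open>t = 0\<close>, this is again a point of the open cell, so that no limit in the
  Schubert variety has to be constructed.\<close>

definition scaled_coords :: "complex \<Rightarrow> nat \<Rightarrow> nat \<Rightarrow> complex" where
  "scaled_coords t i k = (if (i - 1) div q = j \<and> k \<noteq> j then t else 1) * a i k"

lemma scaled_cell_entry:
  "cell_entry q (scaled_coords t) p k = (if p div q = j \<and> Suc k \<noteq> j then t else 1) * cell_entry q a p k"
  using q_pos by (auto simp: cell_entry_def scaled_coords_def)

lemma cell_entry_trivial_column: "Suc k = j \<Longrightarrow> p \<noteq> j * q \<Longrightarrow> cell_entry q a p k = 0"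
  using column_zero by (auto simp: cell_entry_def)

definition block_size :: nat where "block_size = (if j = r then 1 else q)"

text \<open>The diagonal entries of the one-parameter subgroup of lemma \<open>T_J_one_block\<close>.\<close>

definition block_weight :: "complex \<Rightarrow> nat \<Rightarrow> complex" where
  "block_weight z i = inverse z ^ block_size * (if i div q = j then z ^ n else 1)"

text \<open>Among the pivots only that of column \<open>j - 1\<close> lies in block \<open>j\<close>, and it is the only nonzero entry of
  its column. The pivots of the other columns have weight \<open>z\<^sup>-\<^sup>b\<close>; once this is divided out, the scaling
  by \<open>z\<^sup>n\<close> in block \<open>j\<close> remains.\<close>

lemma block_weight_cell_entry:
  "block_weight z p * cell_entry q a p k =
   cell_entry q (scaled_coords (z ^ n)) p k * block_weight z (Suc k * q)"
proof (cases "Suc k = j")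
  case True
  thus ?thesis using cell_entry_trivial_column[of k p] q_pos
    by (cases "p = j * q") (auto simp: scaled_cell_entry)
next
  case False
  moreover have "Suc k * q div q = Suc k" using q_pos by simp
  ultimately show ?thesis
    by (simp add: scaled_cell_entry block_weight_def del: mult_Suc)
qed

text \<open>The positivity of the exponent in \<open>prod_block_weight_pivots\<close>, on which instability rests.\<close>

lemma block_size_less: "block_size * r < n"
proof (cases "j = r")
  case True
  hence "block_size * r = r" unfolding block_size_def by simp
  thus ?thesis using le_mult_self[OF q_pos, of r] unfolding n_eq by linarith
qed (simp add: block_size_def n_eq mult.commute)

lemma prod_block_weight_pivots:
  assumes "z \<noteq> 0"
  shows "(\<Prod>k<r. block_weight z (Suc k * q)) = z ^ (n - block_size * r)"
proof -
  have "(\<Prod>k<r. block_weight z (Suc k * q)) =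
      (\<Prod>k<r. inverse z ^ block_size) * (\<Prod>k<r. if Suc k = j then z ^ n else 1)"
    using q_pos by (simp add: block_weight_def prod.distrib del: mult_Suc)
  also have "(\<Prod>k<r. if Suc k = j then z ^ n else 1) = (\<Prod>k<r. if k = j - 1 then z ^ n else 1)"
    using j by (intro prod.cong) auto
  also have "\<dots> = z ^ n"
  proof -
    have "j - 1 < r" using j by auto
    thus ?thesis by simp
  qed
  also have "(\<Prod>k<r. inverse z ^ block_size) = inverse z ^ (block_size * r)"
    by (simp add: power_mult)
  also have "inverse z ^ (block_size * r) * z ^ n = z ^ (n - block_size * r)"
  proof -
    have "z ^ n = z ^ (block_size * r) * z ^ (n - block_size * r)"
      using block_size_less by (simp flip: power_add)
    thus ?thesis using assms by (simp add: power_inverse field_simps)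
  qed
  finally show ?thesis .
qed

lemma ext_act_cell_vector:
  assumes "z \<noteq> 0"
  shows "ext_act n r (mat_diag n (block_weight z)) (cell_vector a) =
    (\<lambda>I. z ^ (n - block_size * r) * cell_vector (scaled_coords (z ^ n)) I)"
proof
  fix I
  show "ext_act n r (mat_diag n (block_weight z)) (cell_vector a) I =
    z ^ (n - block_size * r) * cell_vector (scaled_coords (z ^ n)) I"
  proof (cases "I \<in> subsets_of_size n r")
    case False
    thus ?thesis by (simp add: ext_act_diag[OF r_le_n] cell_vector_def plucker_def)
  next
    case True
    have "(\<Prod>i\<in>I. block_weight z i) = (\<Prod>x<r. block_weight z (pick I x))"
      by (rule prod.reindex_bij_betw[OF subsets_of_sizeD(3)[OF True], symmetric])
    hence "(\<Prod>i\<in>I. block_weight z i) * cell_vector a I =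
        det (mat r r (\<lambda>(x, k). block_weight z (pick I x) * (cell_entry q a (pick I x) k * \<epsilon> k) * 1))"
      unfolding det_scale_rows_cols cell_vector_det[OF True] by simp
    also have "mat r r (\<lambda>(x, k). block_weight z (pick I x) * (cell_entry q a (pick I x) k * \<epsilon> k) * 1) =
        mat r r (\<lambda>(x, k). 1 * (cell_entry q (scaled_coords (z ^ n)) (pick I x) k * \<epsilon> k) * block_weight z (Suc k * q))"
      using block_weight_cell_entry by (intro cong_mat) (auto simp: algebra_simps)
    also have "det \<dots> = cell_vector (scaled_coords (z ^ n)) I * z ^ (n - block_size * r)"
      unfolding det_scale_rows_cols cell_vector_det[OF True] prod_block_weight_pivots[OF assms] by simp
    finally show ?thesis using True by (simp add: ext_act_diag[OF r_le_n] mult.commute)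
  qed
qed

lemma cell_vector_scaled_tendsto:
  assumes "I \<in> subsets_of_size n r"
  shows "((\<lambda>z. cell_vector (scaled_coords (z ^ n)) I) \<longlongrightarrow> cell_vector (scaled_coords 0) I) (at 0)"
proof -
  have "((\<lambda>z :: complex. z ^ n) \<longlongrightarrow> 0 ^ n) (at 0)" by (intro tendsto_intros)
  hence z: "((\<lambda>z :: complex. z ^ n) \<longlongrightarrow> 0) (at 0)" using n_eq by simp
  have "((\<lambda>z. cell_entry q (scaled_coords (z ^ n)) p k * \<epsilon> k) \<longlongrightarrow> cell_entry q (scaled_coords 0) p k * \<epsilon> k) (at 0)" for p k
    unfolding scaled_cell_entry
    by (cases "p div q = j \<and> Suc k \<noteq> j") (auto intro!: tendsto_mult tendsto_const z intro: tendsto_eq_intros z)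
  thus ?thesis unfolding cell_vector_det[OF assms] by (intro tendsto_det)
qed

text \<open>Near the limit vector the section is a quotient \<open>f / h\<close> with \<open>h \<noteq> 0\<close>. For small \<open>z \<noteq> 0\<close> its value at
  \<open>v\<close> equals its value at \<open>z\<^sup>N v'(z)\<close>, which is \<open>z\<close> raised to \<open>N\<close> times the degree of the section,
  times a convergent factor.\<close>

lemma invariant_section_vanishes:
  assumes "m > 0" "s \<in> sections_O n r X (n * m)" "invariant_section n r (T_J n r q) X s"
  shows "s (cell_vector a) = 0"
proof -
  define v where "v = (\<lambda>t. cell_vector (scaled_coords t))"
  define N where "N = n - block_size * r"
  have N: "N > 0" using block_size_less by (simp add: N_def)
  have v_cone: "(\<lambda>I. c * v t I) \<in> cone n r X" if "c \<noteq> 0" for c t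
    using scaled_cell_vector_cone[OF that] cone_cell_point_subset unfolding v_def by blast
  have "v 0 \<in> cone n r X" using v_cone[of 1 0] by simp
  with assms(2) obtain d f h where f: "f \<in> homog_polys n r (d + n * m)" and h: "h \<in> homog_polys n r d"
    and h0: "h (v 0) \<noteq> 0" and quot: "\<And>u. u \<in> cone n r X \<Longrightarrow> h u \<noteq> 0 \<Longrightarrow> s u = f u / h u"
    unfolding sections_O_def by blast
  have f_lim: "((\<lambda>z. f (v (z ^ n))) \<longlongrightarrow> f (v 0)) (at 0)"
    and h_lim: "((\<lambda>z. h (v (z ^ n))) \<longlongrightarrow> h (v 0)) (at 0)"
    unfolding v_def
    by (intro homog_polys_tendsto[OF f] homog_polys_tendsto[OF h] cell_vector_scaled_tendsto; assumption)+
  have "((\<lambda>z. z ^ (N * (n * m)) * (f (v (z ^ n)) / h (v (z ^ n)))) \<longlongrightarrow> 0 ^ (N * (n * m)) * (f (v 0) / h (v 0))) (at 0)"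
    by (intro tendsto_intros f_lim h_lim h0)
  moreover have "(0 :: complex) ^ (N * (n * m)) = 0"
    using N assms(1) n_eq by (simp add: power_0_left)
  ultimately have lim: "((\<lambda>z. z ^ (N * (n * m)) * (f (v (z ^ n)) / h (v (z ^ n)))) \<longlongrightarrow> 0) (at 0)"
    by simp
  have "eventually (\<lambda>z. h (v (z ^ n)) \<noteq> 0) (at 0)"
    using tendsto_imp_eventually_ne[OF h_lim h0] .
  moreover have "eventually (\<lambda>z :: complex. z \<noteq> 0) (at 0)"
    by (simp add: eventually_at_filter)
  ultimately have "eventually (\<lambda>z. z ^ (N * (n * m)) * (f (v (z ^ n)) / h (v (z ^ n))) = s (cell_vector a)) (at 0)"
  proof eventually_elim
    case (elim z)
    let ?D = "mat_diag n (block_weight z)" and ?u = "\<lambda>I. z ^ N * v (z ^ n) I"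
    have D: "?D \<in> carrier (SL n)" "proj n ?D \<in> T_J n r q"
      using T_J_one_block[OF j n_eq q_pos elim(2)]
      unfolding mat_diag_SL_iff block_weight_def block_size_def by auto
    have "cell_vector a \<in> cone n r X" using cell_vector_cone cone_cell_point_subset by blast
    hence "s (cell_vector a) = s (ext_act n r ?D (cell_vector a))"
      using assms(3) D unfolding invariant_section_def by metis
    also have "ext_act n r ?D (cell_vector a) = ?u"
      unfolding ext_act_cell_vector[OF elim(2)] v_def N_def ..
    also have "s ?u = f ?u / h ?u"
      using elim by (intro quot v_cone) (auto simp: homog_polys_scale[OF h])
    also have "\<dots> = (z ^ N) ^ (n * m) * (f (v (z ^ n)) / h (v (z ^ n)))"
      using elim(2) unfolding homog_polys_scale[OF f] homog_polys_scale[OF h] power_add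
      by simp
    finally show ?case by (simp add: power_mult)
  qed
  from tendsto_cong[OF this] lim have "((\<lambda>_. s (cell_vector a)) \<longlongrightarrow> 0) (at (0 :: complex))" by blast
  thus ?thesis by (simp add: tendsto_const_iff)
qed

lemma cell_point_unstable: "cell_point a \<notin> semistable n r (T_J n r q) X"
  unfolding semistable_def using invariant_section_vanishes cell_vector_cone by blast

end

proposition cell_point_semistable_iff:
  "cell_point a \<in> semistable n r (T_J n r q) X \<longleftrightarrow> (\<forall>j\<in>{1..r}. \<exists>i\<in>C_set q j. a i j \<noteq> 0)"
  using cell_point_semistable[of a] cell_point_unstable[of _ a] by blast

end

theorem theorem4p11:
  fixes r q n :: nat
    and x :: "nat \<Rightarrow> nat \<Rightarrow> complex \<Rightarrow> complex mat set"
    and u :: "complex mat set"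
  assumes "r \<ge> 1" and "q \<ge> 2" and "n = r * q + 1"
    and "\<And>i j. j \<in> {1..r} \<Longrightarrow> i \<in> C_set q j \<Longrightarrow> root_subgroup_iso n i (j * q) (x i j)"
    and "u \<in> U_w n r q"
  shows "(u \<otimes>\<^bsub>PSL n\<^esub> w_rep n r q) <#\<^bsub>PSL n\<^esub> max_parabolic n r
            \<in> semistable n r (T_J n r q) (schubert_variety n r (w_rep n r q))
         \<longleftrightarrow> (\<forall>j\<in>{1..r}. \<exists>i\<in>C_set q j. X_beta n r q x i j u \<noteq> 0)"
proof -
  have q: "q \<ge> 1" using assms(2) by simp
  obtain W \<epsilon> where W: "W \<in> carrier (SL n)" "w_rep n r q = proj n W" "\<And>k. k < r \<Longrightarrow> \<epsilon> k \<noteq> 0"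
    "\<And>p k. p < n \<Longrightarrow> k < r \<Longrightarrow> W $$ (p, k) = (if p = Suc k * q then \<epsilon> k else 0)"
    using w_rep_matrix[OF assms(3) q] by metis
  interpret grassmann_cell n r q W \<epsilon>
    by unfold_locales (fact assms(3) q W)+
  obtain a where a: "u = proj n (cell_unipotent n r q a)"
    using U_w_param[OF assms(3) q assms(5)] .
  have "X_beta n r q x i j u = 0 \<longleftrightarrow> a i j = 0" if "j \<in> {1..r}" "i \<in> C_set q j" for i j
    by (rule X_beta_eq_0_iff[OF assms(3) q assms(4) a that])
  thus ?thesis
    using cell_point_semistable_iff[of a] unfolding cell_point_def a by blast
qed

end
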